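(* For every $\varepsilon > 0$ and every bipartite graph $F$, the following holds for all $\Delta \in \mathbb{N}$ large enough (in terms of $\varepsilon$ and $F$). Let $k \in \mathbb{R}$ satisfy $1/2 \leq k \leq \Delta^{|V(F)|/10}$ and let $$C := \begin{cases} 4+\varepsilon, & \text{if } k \leq \Delta^{\varepsilon |V(F)|/200},\\ 8, & \text{otherwise.}\end{cases}$$ Let $G$ be a $(k,F)$-locally-sparse graph of maximum degree $\Delta$. Then $$\chi(G) \leq \frac{C\,\Delta}{\log\left(\Delta\, k^{-1/|V(F)|}\right)}.$$
   Context: All graphs are finite, undirected and simple; $\log$ is the natural logarithm; $\chi(G)$ is the chromatic number. A copy of $F$ in $G$ is a (not necessarily induced) subgraph of $G$ isomorphic to $F$. For $k\in\mathbb{R}$, a graph $G$ is $(k,F)$-sparse if it contains at most $\lfloor k\rfloor$ copies of $F$ (not necessarily vertex-disjoint). $G$ is $(k,F)$-locally-sparse if for every $v\in V(G)$ the induced subgraph $G[N(v)]$ on the neighborhood of $v$ is $(k,F)$-sparse. *)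

theory Defs
  imports Complex_Main "HOL-Library.Ramsey"
begin

record 'a graph =
  verts :: "'a set"
  edges :: "'a set set"

text \<open>Here \<open>[V]\<^bsup>2\<^esup>\<close> is the set of two-element subsets of \<open>V\<close>.\<close>

definition simple_graph :: "'a graph \<Rightarrow> bool" where
  "simple_graph G \<longleftrightarrow> finite (verts G) \<and> edges G \<subseteq> [verts G]\<^bsup>2\<^esup>"

definition neighborhood :: "'a graph \<Rightarrow> 'a \<Rightarrow> 'a set" where
  "neighborhood G v = {u. {u, v} \<in> edges G}"

definition degree :: "'a graph \<Rightarrow> 'a \<Rightarrow> nat" where
  "degree G v = card (neighborhood G v)"

text \<open>The inserted 0 only gives the graph without vertices the maximum degree 0.\<close>

definition max_degree :: "'a graph \<Rightarrow> nat" where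
  "max_degree G = Max (insert 0 (degree G ` verts G))"

definition induced_subgraph :: "'a graph \<Rightarrow> 'a set \<Rightarrow> 'a graph" where
  "induced_subgraph G W = \<lparr>verts = verts G \<inter> W, edges = {e \<in> edges G. e \<subseteq> W}\<rparr>"

definition subgraph :: "'a graph \<Rightarrow> 'a graph \<Rightarrow> bool" where
  "subgraph H G \<longleftrightarrow> simple_graph H \<and> verts H \<subseteq> verts G \<and> edges H \<subseteq> edges G"

definition isomorphic :: "'a graph \<Rightarrow> 'b graph \<Rightarrow> bool" where
  "isomorphic G H \<longleftrightarrow>
     (\<exists>f. bij_betw f (verts G) (verts H) \<and>
          (\<forall>u \<in> verts G. \<forall>v \<in> verts G. {u, v} \<in> edges G \<longleftrightarrow> {f u, f v} \<in> edges H))"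

definition bipartite :: "'a graph \<Rightarrow> bool" where
  "bipartite G \<longleftrightarrow>
     (\<exists>A B. A \<union> B = verts G \<and> A \<inter> B = {} \<and>
            (\<forall>e \<in> edges G. \<exists>a \<in> A. \<exists>b \<in> B. e = {a, b}))"

definition proper_coloring :: "'a graph \<Rightarrow> nat \<Rightarrow> ('a \<Rightarrow> nat) \<Rightarrow> bool" where
  "proper_coloring G n c \<longleftrightarrow>
     c ` verts G \<subseteq> {..<n} \<and> (\<forall>u v. {u, v} \<in> edges G \<longrightarrow> c u \<noteq> c v)"

definition chromatic_number :: "'a graph \<Rightarrow> nat" where
  "chromatic_number G = (LEAST n. \<exists>c. proper_coloring G n c)"

text \<open>
  Copies are subgraphs, not embeddings: embeddings of \<open>F\<close> that differ by an automorphism of \<open>F\<close>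
  give the same copy. Two copies are equal iff they have the same vertices and the same edges, so
  isolated vertices of \<open>F\<close> matter.
\<close>

definition copies :: "'b graph \<Rightarrow> 'a graph \<Rightarrow> 'a graph set" where
  "copies F G = {H. subgraph H G \<and> isomorphic H F}"

definition sparse :: "real \<Rightarrow> 'b graph \<Rightarrow> 'a graph \<Rightarrow> bool" where
  "sparse k F G \<longleftrightarrow> int (card (copies F G)) \<le> \<lfloor>k\<rfloor>"

definition locally_sparse :: "real \<Rightarrow> 'b graph \<Rightarrow> 'a graph \<Rightarrow> bool" where
  "locally_sparse k F G \<longleftrightarrow>
     (\<forall>v \<in> verts G. sparse k F (induced_subgraph G (neighborhood G v)))"

end

theory Submission imports Defs "HOL-Library.FuncSet" "HOL-Real_Asymp.Real_Asymp"
begin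

text \<open>Since \<open>k \<ge> 1/2\<close> and \<open>C \<ge> 4\<close>, it suffices to colour with \<open>q\<close> colours, where \<open>q\<close> is about
  \<open>4\<Delta> / ln \<Delta>\<close>. Following Rosenfeld's counting method, one shows by induction on the vertex set that
  adding a vertex \<open>v\<close> multiplies the number of proper \<open>q\<close>-colourings by at least \<open>\<Delta> powr (1/4)\<close>. By the
  induction hypothesis, in a uniformly random colouring of the rest few neighbours of \<open>v\<close> have fewer
  than \<open>\<Delta> powr (1/5)\<close> available colours. For a colour \<open>\<gamma>\<close>, recolour at random the neighbours of \<open>v\<close> of colour
  \<open>\<gamma>\<close>. Given the resulting colouring, in which \<open>\<gamma>\<close> is available at \<open>v\<close>, the recoloured vertices form a
  random independent set \<open>I\<close> drawn from a hard-core model in \<open>G[N(v)]\<close> whose fugacities are at most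
  \<open>\<Delta> powr (- 1/5)\<close>. As \<open>N(v)\<close> contains few copies of \<open>F\<close>, by Sidorenko's inequality for complete bipartite
  graphs such a model of total weight \<open>O(ln \<Delta>)\<close> has hardly any edge weight, so its partition function
  is at most \<open>exp (1 + E|I|)\<close>. The mean of \<open>E|I|\<close> over the colours is at most \<open>\<Delta> / q\<close>, whence \<open>v\<close> has
  on average at least about \<open>q exp (- 2\<Delta> / q)\<close> available colours.\<close>

subsection \<open>The hard-core model\<close>

definition indep_sets :: "('a \<Rightarrow> 'a \<Rightarrow> bool) \<Rightarrow> 'a set \<Rightarrow> 'a set set" where
  "indep_sets E S = {I. I \<subseteq> S \<and> (\<forall>u\<in>I. \<forall>w\<in>I. \<not> E u w)}"

text \<open>Ordered pairs are summed, so for a symmetric \<open>E\<close> each edge counts twice;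
  this is the form in which a union bound over blocking neighbours produces it.\<close>

definition edge_weight :: "('a \<Rightarrow> 'a \<Rightarrow> bool) \<Rightarrow> ('a \<Rightarrow> real) \<Rightarrow> 'a set \<Rightarrow> real" where
  "edge_weight E l S = (\<Sum>u\<in>S. \<Sum>w\<in>S. l u * l w * of_bool (E u w))"

lemma finite_indep_sets: "finite S \<Longrightarrow> finite (indep_sets E S)"
  by (rule finite_subset[of _ "Pow S"]) (auto simp: indep_sets_def)

lemma indep_sets_finite: "finite S \<Longrightarrow> I \<in> indep_sets E S \<Longrightarrow> finite I"
  by (auto simp: indep_sets_def intro: finite_subset)

text \<open>Forgetting independence turns the partition function into the product of all
  \<open>1 + l u\<close>, and \<open>1 + t\<close> is at most \<open>exp t\<close>.\<close>

lemma hard_core_partition_le: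
  fixes l :: "'a \<Rightarrow> real"
  assumes S: "finite S" and l: "\<And>u. u \<in> S \<Longrightarrow> 0 \<le> l u"
  shows "(\<Sum>I\<in>indep_sets E S. \<Prod>u\<in>I. l u) \<le> exp (\<Sum>u\<in>S. l u)"
proof -
  have "(\<Sum>I\<in>indep_sets E S. \<Prod>u\<in>I. l u) \<le> (\<Sum>I\<in>Pow S. \<Prod>u\<in>I. l u)"
    by (rule sum_mono2) (use S l in \<open>auto simp: indep_sets_def intro!: prod_nonneg\<close>)
  also have "\<dots> = (\<Prod>u\<in>S. l u + 1)"
    using prod_add[OF S, of l "\<lambda>_. 1"] by simp
  also have "\<dots> \<le> (\<Prod>u\<in>S. exp (l u))"
    by (rule prod_mono) (use l in \<open>auto simp: add.commute add_nonneg_nonneg\<close>)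
  also have "\<dots> = exp (\<Sum>u\<in>S. l u)"
    by (rule exp_sum[OF S, symmetric])
  finally show ?thesis .
qed

text \<open>Removing \<open>w\<close> is injective on the independent sets containing it, lands in
  the independent sets and costs the factor \<open>l w\<close>. So the occupation probability of
  \<open>w\<close> is at most its fugacity.\<close>

lemma hard_core_vertex_le:
  fixes l :: "'a \<Rightarrow> real"
  assumes S: "finite S" and l: "\<And>u. u \<in> S \<Longrightarrow> 0 \<le> l u" and w: "w \<in> S"
  shows "(\<Sum>I | I \<in> indep_sets E S \<and> w \<in> I. \<Prod>u\<in>I. l u)
           \<le> l w * (\<Sum>I\<in>indep_sets E S. \<Prod>u\<in>I. l u)"
proof -
  have "(\<Sum>I | I \<in> indep_sets E S \<and> w \<in> I. \<Prod>u\<in>I. l u)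
      = (\<Sum>I | I \<in> indep_sets E S \<and> w \<in> I. l w * (\<Prod>u\<in>I - {w}. l u))"
    by (rule sum.cong) (auto simp: prod.remove[OF indep_sets_finite[OF S]])
  also have "\<dots> = (\<Sum>J\<in>(\<lambda>I. I - {w}) ` {I. I \<in> indep_sets E S \<and> w \<in> I}. l w * (\<Prod>u\<in>J. l u))"
    by (subst sum.reindex) (auto simp: inj_on_def)
  also have "\<dots> \<le> (\<Sum>J\<in>indep_sets E S. l w * (\<Prod>u\<in>J. l u))"
    by (rule sum_mono2)
       (use S l w in \<open>auto simp: finite_indep_sets indep_sets_def intro!: mult_nonneg_nonneg prod_nonneg\<close>)
  finally show ?thesis by (simp add: sum_distrib_left)
qed

text \<open>A vertex \<open>u\<close> can be added to \<open>I\<close> unless \<open>I\<close>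
  already contains \<open>u\<close> or one of its neighbours. By a union bound over these obstacles
  \<open>u\<close> is occupied with probability at least \<open>l u\<close> times one minus their
  weight, and summing over \<open>u\<close> gives the mean size. Multiplying by the partition
  function avoids division.\<close>

lemma hard_core_expectation_ge:
  fixes l :: "'a \<Rightarrow> real"
  assumes S: "finite S" and l: "\<And>u. u \<in> S \<Longrightarrow> 0 \<le> l u"
    and E: "\<And>u w. E u w \<Longrightarrow> E w u" "\<And>u. \<not> E u u"
  shows "((\<Sum>u\<in>S. l u) - (\<Sum>u\<in>S. (l u)\<^sup>2) - edge_weight E l S) * (\<Sum>I\<in>indep_sets E S. \<Prod>u\<in>I. l u)
           \<le> (\<Sum>I\<in>indep_sets E S. (\<Prod>u\<in>I. l u) * real (card I))"
proof -
  define m where "m I = (\<Prod>u\<in>I. l u)" for I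
  define A where "A = indep_sets E S"
  define Z where "Z = (\<Sum>I\<in>A. m I)"
  have finA: "finite A" by (simp add: A_def finite_indep_sets S)
  have mpos: "0 \<le> m I" if "I \<in> A" for I
    using that l by (auto simp: A_def m_def indep_sets_def intro!: prod_nonneg)
  have le: "(\<Sum>I | I \<in> A \<and> w \<in> I. m I) \<le> l w * Z" if "w \<in> S" for w
    using hard_core_vertex_le[OF S l that, where E=E] by (simp add: A_def m_def Z_def)
  have "l u * (Z - l u * Z - (\<Sum>w\<in>S. of_bool (E u w) * (l w * Z))) \<le> (\<Sum>I | I \<in> A \<and> u \<in> I. m I)"
    if u: "u \<in> S" for u
  proof -
    \<comment> \<open>The independent sets to which \<open>u\<close> can be added; inserting
      \<open>u\<close> maps \<open>B\<close> bijectively to the independent sets containing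
      \<open>u\<close>.\<close>
    define B where "B = {J \<in> A. u \<notin> J \<and> (\<forall>w\<in>J. \<not> E u w)}"
    have eq: "(\<Sum>I | I \<in> A \<and> u \<in> I. m I) = (\<Sum>J\<in>B. l u * m J)"
    proof (rule sum.reindex_bij_witness[of _ "insert u" "\<lambda>I. I - {u}"])
      show "l u * m (I - {u}) = m I" if "I \<in> {I. I \<in> A \<and> u \<in> I}" for I
        using that prod.remove[of I u l] indep_sets_finite[OF S] by (auto simp: m_def A_def)
    qed (use u E in \<open>auto simp: A_def B_def indep_sets_def\<close>)
    have eq': "(\<Sum>I\<in>A. of_bool (w \<in> I) * m I) = (\<Sum>I | I \<in> A \<and> w \<in> I. m I)" for w
      by (rule sum.mono_neutral_cong_right) (use finA in auto)
    \<comment> \<open>Every independent set is in \<open>B\<close>, contains \<open>u\<close>, or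
      contains a neighbour of \<open>u\<close>.\<close>
    have "m I \<le> of_bool (I \<in> B) * m I + of_bool (u \<in> I) * m I
            + (\<Sum>w\<in>S. of_bool (E u w) * (of_bool (w \<in> I) * m I))" if I: "I \<in> A" for I
    proof (cases "I \<in> B \<or> u \<in> I")
      case True
      have "0 \<le> (\<Sum>w\<in>S. of_bool (E u w) * (of_bool (w \<in> I) * m I))"
        by (intro sum_nonneg mult_nonneg_nonneg mpos I) auto
      with True mpos[OF I] show ?thesis by (auto simp: add_increasing add_increasing2)
    next
      case False
      then obtain w where w: "w \<in> I" "E u w" "w \<in> S"
        using I by (auto simp: B_def A_def indep_sets_def)
      have "of_bool (E u w) * (of_bool (w \<in> I) * m I)
          \<le> (\<Sum>w\<in>S. of_bool (E u w) * (of_bool (w \<in> I) * m I))"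
        by (rule member_le_sum) (use S w mpos[OF I] in auto)
      with w mpos[OF I] False show ?thesis by simp
    qed
    then have "Z \<le> (\<Sum>I\<in>A. of_bool (I \<in> B) * m I + of_bool (u \<in> I) * m I
            + (\<Sum>w\<in>S. of_bool (E u w) * (of_bool (w \<in> I) * m I)))"
      unfolding Z_def by (rule sum_mono)
    also have "\<dots> = (\<Sum>I\<in>A. of_bool (I \<in> B) * m I) + (\<Sum>I\<in>A. of_bool (u \<in> I) * m I)
            + (\<Sum>w\<in>S. of_bool (E u w) * (\<Sum>I\<in>A. of_bool (w \<in> I) * m I))"
      by (simp add: sum.distrib sum_distrib_left sum.swap[of _ S A])
    also have "(\<Sum>I\<in>A. of_bool (I \<in> B) * m I) = (\<Sum>J\<in>B. m J)"
      by (rule sum.mono_neutral_cong_right) (use finA in \<open>auto simp: B_def\<close>)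
    also have "(\<Sum>J\<in>B. m J) + (\<Sum>I\<in>A. of_bool (u \<in> I) * m I)
            + (\<Sum>w\<in>S. of_bool (E u w) * (\<Sum>I\<in>A. of_bool (w \<in> I) * m I))
          \<le> (\<Sum>J\<in>B. m J) + l u * Z + (\<Sum>w\<in>S. of_bool (E u w) * (l w * Z))"
      unfolding eq' by (intro add_mono order.refl le u sum_mono mult_left_mono) auto
    finally have "Z - l u * Z - (\<Sum>w\<in>S. of_bool (E u w) * (l w * Z)) \<le> (\<Sum>J\<in>B. m J)"
      by linarith
    then show ?thesis
      unfolding eq sum_distrib_left[symmetric] by (rule mult_left_mono) (rule l[OF u])
  qed
  then have "(\<Sum>u\<in>S. l u * (Z - l u * Z - (\<Sum>w\<in>S. of_bool (E u w) * (l w * Z))))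
       \<le> (\<Sum>u\<in>S. \<Sum>I | I \<in> A \<and> u \<in> I. m I)"
    by (rule sum_mono)
  also have "\<dots> = (\<Sum>u\<in>S. \<Sum>I\<in>A. of_bool (u \<in> I) * m I)"
    by (intro sum.cong sum.mono_neutral_cong_left) (use finA in auto)
  also have "\<dots> = (\<Sum>I\<in>A. \<Sum>u\<in>S. of_bool (u \<in> I) * m I)"
    by (rule sum.swap)
  also have "\<dots> = (\<Sum>I\<in>A. m I * real (card I))"
  proof (rule sum.cong[OF refl])
    fix I assume "I \<in> A"
    then have "S \<inter> {u. u \<in> I} = I" by (auto simp: A_def indep_sets_def)
    then show "(\<Sum>u\<in>S. of_bool (u \<in> I) * m I) = m I * real (card I)"
      using S by (simp add: sum_distrib_right[symmetric] sum_of_bool_eq)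
  qed
  also have "(\<Sum>u\<in>S. l u * (Z - l u * Z - (\<Sum>w\<in>S. of_bool (E u w) * (l w * Z))))
      = ((\<Sum>u\<in>S. l u) - (\<Sum>u\<in>S. (l u)\<^sup>2) - edge_weight E l S) * Z"
    by (simp add: edge_weight_def algebra_simps sum.distrib sum_subtractf sum_distrib_left
        power2_eq_square)
  finally show ?thesis by (simp add: A_def Z_def m_def)
qed

text \<open>Chebyshev's sum inequality: \<open>card I\<close> and \<open>x ^ card I\<close> are
  oppositely ordered, so damping all fugacities by a common factor cannot raise the mean size. Both
  means are cleared of denominators.\<close>

lemma hard_core_expectation_mono:
  fixes l :: "'a \<Rightarrow> real" and x :: real
  assumes S: "finite S" and l: "\<And>u. u \<in> S \<Longrightarrow> 0 \<le> l u" and x: "0 \<le> x" "x \<le> 1"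
  shows "(\<Sum>I\<in>indep_sets E S. (\<Prod>u\<in>I. x * l u) * real (card I)) * (\<Sum>I\<in>indep_sets E S. \<Prod>u\<in>I. l u)
    \<le> (\<Sum>I\<in>indep_sets E S. (\<Prod>u\<in>I. l u) * real (card I)) * (\<Sum>I\<in>indep_sets E S. \<Prod>u\<in>I. x * l u)"
proof -
  define m where "m I = (\<Prod>u\<in>I. l u)" for I
  define A where "A = indep_sets E S"
  have mpos: "0 \<le> m I" if "I \<in> A" for I
    using that l by (auto simp: A_def m_def indep_sets_def intro!: prod_nonneg)
  have mx: "(\<Prod>u\<in>I. x * l u) = x ^ card I * m I" for I
    by (simp add: prod.distrib m_def)
  define P where "P I J = m I * m J * (real (card I) - real (card J)) * x ^ card J" for I J
  \<comment> \<open>A single \<open>P I J\<close> may be negative; symmetrising over the two sets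
    gives, up to nonnegative weights, a product of two factors of the same sign.\<close>
  have "0 \<le> P I J + P J I" if "I \<in> A" "J \<in> A" for I J
  proof -
    have "0 \<le> (real (card I) - real (card J)) * (x ^ card J - x ^ card I)"
    proof (cases "card I \<le> card J")
      case True
      then show ?thesis using power_decreasing[OF True x] by (intro mult_nonpos_nonpos) auto
    next
      case False
      then show ?thesis using power_decreasing[of "card J" "card I" x] x by (intro mult_nonneg_nonneg) auto
    qed
    then have "0 \<le> (m I * m J) * ((real (card I) - real (card J)) * (x ^ card J - x ^ card I))"
      using mpos[OF that(1)] mpos[OF that(2)] by (metis mult_nonneg_nonneg)
    then show ?thesis by (simp add: P_def algebra_simps)
  qed
  then have "0 \<le> (\<Sum>I\<in>A. \<Sum>J\<in>A. P I J + P J I)"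
    by (intro sum_nonneg) auto
  also have "\<dots> = 2 * (\<Sum>I\<in>A. \<Sum>J\<in>A. P I J)"
    using sum.swap[of "\<lambda>I J. P I J" A A] by (simp add: sum.distrib)
  finally have "0 \<le> (\<Sum>I\<in>A. \<Sum>J\<in>A. P I J)" by simp
  also have "\<dots> = (\<Sum>I\<in>A. m I * real (card I)) * (\<Sum>J\<in>A. x ^ card J * m J)
      - (\<Sum>J\<in>A. x ^ card J * m J * real (card J)) * (\<Sum>I\<in>A. m I)"
    unfolding sum_product sum.swap[of "\<lambda>i j. x ^ card i * m i * real (card i) * m j"] sum_subtractf[symmetric]
    by (intro sum.cong refl) (simp add: P_def algebra_simps)
  finally show ?thesis by (simp add: A_def[symmetric] mx) (simp add: m_def)
qed

text \<open>The tangent at \<open>y\<close> of \<open>exp (- 1 - Y)\<close>, where \<open>Y\<close> is the mean size of a random independent set.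
  It allows averaging over many hard-core models without any concentration.\<close>

lemma hard_core_tangent:
  fixes l :: "'a \<Rightarrow> real" and y \<tau> :: real
  assumes S: "finite S" and l: "\<And>u. u \<in> S \<Longrightarrow> 0 \<le> l u" "\<And>u. u \<in> S \<Longrightarrow> l u \<le> \<tau>"
    and E: "\<And>u w. E u w \<Longrightarrow> E w u" "\<And>u. \<not> E u u"
    and y: "0 \<le> y" and \<tau>: "\<tau> * (y + 2) \<le> 1 / 2"
    and sparse: "\<And>l'. (\<And>u. u \<in> S \<Longrightarrow> 0 \<le> l' u) \<Longrightarrow> (\<And>u. u \<in> S \<Longrightarrow> l' u \<le> \<tau>) \<Longrightarrow>
                   (\<Sum>u\<in>S. l' u) \<le> y + 2 \<Longrightarrow> edge_weight E l' S \<le> 1 / 2"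
  shows "(\<Sum>I\<in>indep_sets E S. (\<Prod>u\<in>I. l u) * (exp (- 1 - y) * (1 + y - real (card I)))) \<le> 1"
proof -
  define A where "A = indep_sets E S"
  define Z where "Z l = (\<Sum>I\<in>A. \<Prod>u\<in>I. l u)" for l :: "'a \<Rightarrow> real"
  define N where "N l = (\<Sum>I\<in>A. (\<Prod>u\<in>I. l u) * real (card I))" for l :: "'a \<Rightarrow> real"
  define T where "T = (\<Sum>u\<in>S. l u)"
  have T0: "0 \<le> T" using l by (auto simp: T_def intro: sum_nonneg)
  have Z1: "0 < Z l'" if "\<And>u. u \<in> S \<Longrightarrow> 0 \<le> l' u" for l'
  proof -
    have "(\<Prod>u\<in>{}. l' u) \<le> Z l'" unfolding Z_def
      by (rule member_le_sum)
         (use S that in \<open>auto simp: A_def finite_indep_sets indep_sets_def intro!: prod_nonneg\<close>)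
    then show ?thesis by simp
  qed
  \<comment> \<open>As long as the total weight is at most \<open>y + 2\<close>, the squares and the
    edges each lose at most 1/2, so the mean size is at least the total weight minus 1.\<close>
  have key: "((\<Sum>u\<in>S. l' u) - 1) * Z l' \<le> N l'"
    if l': "\<And>u. u \<in> S \<Longrightarrow> 0 \<le> l' u" "\<And>u. u \<in> S \<Longrightarrow> l' u \<le> \<tau>" "(\<Sum>u\<in>S. l' u) \<le> y + 2" for l'
  proof -
    have "(\<Sum>u\<in>S. (l' u)\<^sup>2) \<le> (\<Sum>u\<in>S. \<tau> * l' u)"
      unfolding power2_eq_square by (intro sum_mono mult_right_mono l')
    also have "\<dots> = \<tau> * (\<Sum>u\<in>S. l' u)" by (simp add: sum_distrib_left)
    also have "\<dots> \<le> 1 / 2"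
    \<comment> \<open>The sign of \<open>\<tau>\<close> is known once \<open>S\<close> has a vertex,
      whose fugacity lies between 0 and \<open>\<tau>\<close>.\<close>
    proof (cases "S = {}")
      case False
      then have "0 \<le> \<tau>" using l' by (metis equals0I order.trans)
      then have "\<tau> * (\<Sum>u\<in>S. l' u) \<le> \<tau> * (y + 2)" using l' by (intro mult_left_mono) auto
      with \<tau> show ?thesis by linarith
    qed auto
    finally have "(\<Sum>u\<in>S. l' u) - 1 \<le> (\<Sum>u\<in>S. l' u) - (\<Sum>u\<in>S. (l' u)\<^sup>2) - edge_weight E l' S"
      using sparse[OF l'] by linarith
    then have "((\<Sum>u\<in>S. l' u) - 1) * Z l'
        \<le> ((\<Sum>u\<in>S. l' u) - (\<Sum>u\<in>S. (l' u)\<^sup>2) - edge_weight E l' S) * Z l'"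
      using Z1[of l'] l' by (intro mult_right_mono) (auto intro: less_imp_le)
    also have "\<dots> \<le> N l'"
      using hard_core_expectation_ge[OF S, where l=l' and E=E] l' E by (simp add: A_def Z_def N_def)
    finally show ?thesis .
  qed
  have Zpos: "0 < Z l" using Z1 l by auto
  have "(1 + y) * Z l - N l \<le> exp (1 + y)"
  proof (cases "T \<le> y + 2")
    case True
    define Y where "Y = N l / Z l"
    have "T \<le> 1 + Y" using key[of l] l True Zpos by (simp add: T_def Y_def field_simps)
    then have "Z l \<le> exp (1 + Y)"
      using hard_core_partition_le[OF S, of l E] l by (auto simp: Z_def A_def T_def intro: order.trans)
    \<comment> \<open>The tangent of \<open>exp\<close> at 0 turns the bound
      \<open>exp (1 + Y)\<close> on \<open>Z l\<close> into one that is linear in the mean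
      \<open>Y\<close>.\<close>
    moreover have "1 + (y - Y) \<le> exp (y - Y)" by (rule exp_ge_add_one_self)
    ultimately have "(1 + (y - Y)) * Z l \<le> exp (y - Y) * exp (1 + Y)"
      using Zpos by (intro mult_mono) auto
    also have "\<dots> = exp (1 + y)" by (simp add: exp_add[symmetric] add.commute)
    also have "(1 + (y - Y)) * Z l = (1 + y) * Z l - N l"
      using Zpos by (simp add: Y_def algebra_simps)
    finally show ?thesis .
  next
    case False
    \<comment> \<open>Fugacities too large for \<open>key\<close> are scaled down to total weight
      exactly \<open>y + 2\<close>. There the mean size is at least \<open>y + 1\<close>; by
      monotonicity the same holds for \<open>l\<close>, so the left-hand side is
      nonpositive.\<close>
    define x where "x = (y + 2) / T"
    have x: "0 \<le> x" "x \<le> 1" using False y by (auto simp: x_def)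
    have sx: "(\<Sum>u\<in>S. x * l u) = y + 2"
      unfolding sum_distrib_left[symmetric] T_def[symmetric] using False y by (simp add: x_def)
    have b: "0 \<le> x * l u \<and> x * l u \<le> \<tau>" if "u \<in> S" for u
      using l[OF that] x by (auto intro: order.trans[OF mult_left_le_one_le])
    have "(1 + y) * Z (\<lambda>u. x * l u) \<le> N (\<lambda>u. x * l u)"
      using key[of "\<lambda>u. x * l u"] b sx by auto
    then have "(1 + y) * Z (\<lambda>u. x * l u) * Z l \<le> N (\<lambda>u. x * l u) * Z l"
      using Zpos by (intro mult_right_mono) auto
    also have "\<dots> \<le> N l * Z (\<lambda>u. x * l u)"
      using hard_core_expectation_mono[OF S l(1) x, where E=E] by (simp add: A_def Z_def N_def)
    finally have "((1 + y) * Z l) * Z (\<lambda>u. x * l u) \<le> N l * Z (\<lambda>u. x * l u)"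
      by (simp add: mult_ac)
    then have "(1 + y) * Z l \<le> N l"
      using Z1[of "\<lambda>u. x * l u"] b by auto
    then show ?thesis by (smt (verit) exp_gt_zero)
  qed
  then have "exp (- 1 - y) * ((1 + y) * Z l - N l) \<le> exp (- 1 - y) * exp (1 + y)"
    by (intro mult_left_mono) auto
  also have "\<dots> = 1" by (simp add: exp_add[symmetric])
  finally show ?thesis
    by (simp add: Z_def N_def A_def sum_distrib_left sum_subtractf[symmetric] algebra_simps)
qed

subsection \<open>Edge weight and copies of a bipartite graph\<close>

text \<open>Jensen's inequality for the \<open>n\<close>-th power, from its tangent at the weighted
  mean; after division by the mean this tangent bound is Bernoulli's inequality.\<close>

lemma weighted_power_mean:
  fixes w x :: "'a \<Rightarrow> real"
  assumes S: "finite S" and w: "\<And>s. s \<in> S \<Longrightarrow> 0 \<le> w s" and x: "\<And>s. s \<in> S \<Longrightarrow> 0 \<le> x s"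
    and W: "0 < (\<Sum>s\<in>S. w s)"
  shows "(\<Sum>s\<in>S. w s) * ((\<Sum>s\<in>S. w s * x s) / (\<Sum>s\<in>S. w s)) ^ n \<le> (\<Sum>s\<in>S. w s * x s ^ n)"
proof -
  define \<mu> where "\<mu> = (\<Sum>s\<in>S. w s * x s) / (\<Sum>s\<in>S. w s)"
  have \<mu>W: "\<mu> * (\<Sum>s\<in>S. w s) = (\<Sum>s\<in>S. w s * x s)" using W by (simp add: \<mu>_def)
  have \<mu>0: "0 \<le> \<mu>" using w x W by (auto simp: \<mu>_def intro!: divide_nonneg_pos sum_nonneg)
  show ?thesis
  proof (cases "\<mu> = 0")
    case True
    have "0 \<le> (\<Sum>s\<in>S. w s * x s ^ n)" using w x by (auto intro!: sum_nonneg)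
    with True show ?thesis by (cases n) (auto simp: \<mu>_def[symmetric])
  next
    case False
    with \<mu>0 have pos: "0 < \<mu>" by simp
    have "(\<Sum>s\<in>S. w s) * \<mu> ^ n = (\<Sum>s\<in>S. w s * (\<mu> ^ n * (1 + real n * (x s / \<mu> - 1))))"
    proof -
      have "(\<Sum>s\<in>S. w s * (\<mu> ^ n * (1 + real n * (x s / \<mu> - 1))))
         = (\<Sum>s\<in>S. \<mu> ^ n * (w s + real n * (w s * x s / \<mu> - w s)))"
        by (intro sum.cong refl) (simp add: algebra_simps)
      also have "\<dots> = \<mu> ^ n * ((\<Sum>s\<in>S. w s) + real n * ((\<Sum>s\<in>S. w s * x s) / \<mu> - (\<Sum>s\<in>S. w s)))"
        by (simp add: sum.distrib sum_subtractf sum_divide_distrib flip: sum_distrib_left)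
      also have "(\<Sum>s\<in>S. w s * x s) / \<mu> = (\<Sum>s\<in>S. w s)" using \<mu>W pos by (simp add: field_simps)
      finally show ?thesis
        by (simp only: diff_self mult_zero_right add_0_right mult.commute[of "sum w S"])
    qed
    also have "\<dots> \<le> (\<Sum>s\<in>S. w s * x s ^ n)"
    proof (intro sum_mono mult_left_mono w)
      fix s assume s: "s \<in> S"
      have "1 + real n * (x s / \<mu> - 1) \<le> (1 + (x s / \<mu> - 1)) ^ n"
        by (rule Bernoulli_inequality) (use x[OF s] pos in simp)
      then have "\<mu> ^ n * (1 + real n * (x s / \<mu> - 1)) \<le> \<mu> ^ n * (x s / \<mu>) ^ n"
        using pos by (intro mult_left_mono) auto
      also have "\<dots> = x s ^ n" using pos by (simp add: power_divide)
      finally show "\<mu> ^ n * (1 + real n * (x s / \<mu> - 1)) \<le> x s ^ n" .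
    qed
    finally show ?thesis by (simp add: \<mu>_def)
  qed
qed

text \<open>Homomorphisms of the complete bipartite graph with sides \<open>A\<close> and
  \<open>B\<close>, which contains every bipartite graph with these sides. For disjoint sides,
  extensional maps correspond bijectively to pairs of maps on \<open>A\<close> and on
  \<open>B\<close>.\<close>

definition bihoms :: "('a \<Rightarrow> 'a \<Rightarrow> bool) \<Rightarrow> 'b set \<Rightarrow> 'b set \<Rightarrow> 'a set \<Rightarrow> ('b \<Rightarrow> 'a) set" where
  "bihoms E A B S = {h \<in> (A \<union> B) \<rightarrow>\<^sub>E S. \<forall>a\<in>A. \<forall>b\<in>B. E (h a) (h b)}"

text \<open>Two applications of the power mean inequality: first over a common neighbour
  \<open>s\<close> of the image of \<open>A\<close>, then over the maps of \<open>A\<close>, whose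
  common neighbourhood is filled independently by the vertices of \<open>B\<close>.\<close>

lemma bihoms_weight_ge:
  fixes l :: "'a \<Rightarrow> real" and A B :: "'b set"
  assumes S: "finite S" and l: "\<And>u. u \<in> S \<Longrightarrow> 0 \<le> l u" and T: "0 < (\<Sum>u\<in>S. l u)"
    and A: "finite A" and B: "finite B" and AB: "A \<inter> B = {}"
  shows "(\<Sum>u\<in>S. l u) ^ card (A \<union> B) * (edge_weight E l S / (\<Sum>u\<in>S. l u)\<^sup>2) ^ (card A * card B)
           \<le> (\<Sum>h\<in>bihoms E A B S. \<Prod>v\<in>A \<union> B. l (h v))"
proof -
  define T where "T = (\<Sum>u\<in>S. l u)"
  have T0: "0 < T" using T by (simp add: T_def)
  define e where "e = edge_weight E l S"
  \<comment> \<open>\<open>d s\<close> weighs the vertices adjacent to \<open>s\<close>, and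
    \<open>f x\<close> the common neighbours of the values of \<open>x\<close>.\<close>
  define d where "d s = (\<Sum>r\<in>S. l r * of_bool (E r s))" for s
  define f where "f x = (\<Sum>s\<in>S. l s * (\<Prod>a\<in>A. of_bool (E (x a) s)))" for x :: "'b \<Rightarrow> 'a"
  have ed: "e = (\<Sum>s\<in>S. l s * d s)"
    unfolding e_def edge_weight_def d_def sum_distrib_left
    by (subst sum.swap) (auto intro!: sum.cong)
  have e0: "0 \<le> e" using l by (auto simp: e_def edge_weight_def intro!: sum_nonneg)
  have d0: "0 \<le> d s" for s using l by (auto simp: d_def intro!: sum_nonneg)
  have f0: "0 \<le> f x" for x using l by (auto simp: f_def intro!: sum_nonneg mult_nonneg_nonneg prod_nonneg)
  have Tpow: "(\<Sum>x\<in>A \<rightarrow>\<^sub>E S. \<Prod>a\<in>A. l (x a)) = T ^ card A"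
    using prod_sum_PiE[of A "\<lambda>_. S" "\<lambda>_ y. l y"] A S by (simp add: T_def)
  have w0: "0 \<le> (\<Prod>a\<in>A. l (x a))" if "x \<in> A \<rightarrow>\<^sub>E S" for x
    using that l by (auto intro!: prod_nonneg)
  \<comment> \<open>Expanding \<open>d s ^ card A\<close> over the maps of \<open>A\<close> and
    exchanging sums turns stars centred at \<open>s\<close> into common neighbours of
    \<open>x\<close>.\<close>
  have first: "T * (e / T) ^ card A \<le> (\<Sum>x\<in>A \<rightarrow>\<^sub>E S. (\<Prod>a\<in>A. l (x a)) * f x)"
  proof -
    have "T * (e / T) ^ card A \<le> (\<Sum>s\<in>S. l s * d s ^ card A)"
      using weighted_power_mean[OF S, of l d "card A"] l d0 T by (simp add: ed T_def)
    also have "\<dots> = (\<Sum>s\<in>S. l s * (\<Sum>x\<in>A \<rightarrow>\<^sub>E S. \<Prod>a\<in>A. l (x a) * of_bool (E (x a) s)))"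
      using prod_sum_PiE[of A "\<lambda>_. S" "\<lambda>_ y. l y * of_bool (E y _)"] A S by (simp add: d_def)
    also have "\<dots> = (\<Sum>x\<in>A \<rightarrow>\<^sub>E S. (\<Prod>a\<in>A. l (x a)) * f x)"
      unfolding f_def sum_distrib_left prod.distrib
      by (subst sum.swap) (simp add: mult_ac)
    finally show ?thesis .
  qed
  have "T ^ card (A \<union> B) * (e / T\<^sup>2) ^ (card A * card B)
      = T ^ card A * ((T * (e / T) ^ card A) / T ^ card A) ^ card B"
  proof -
    have "(T * (e / T) ^ card A) / T ^ card A = T * (e / T\<^sup>2) ^ card A"
      using T0 by (simp add: power_divide power2_eq_square power_mult_distrib)
    then show ?thesis
      by (simp add: card_Un_disjoint[OF A B AB] power_add power_mult power_mult_distrib)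
  qed
  also have "\<dots> \<le> T ^ card A * ((\<Sum>x\<in>A \<rightarrow>\<^sub>E S. (\<Prod>a\<in>A. l (x a)) * f x) / T ^ card A) ^ card B"
    using T0 e0 first by (intro mult_left_mono power_mono divide_right_mono) auto
  \<comment> \<open>The second power mean, with the maps \<open>x\<close> as points and total weight
    \<open>T ^ card A\<close>.\<close>
  also have "\<dots> \<le> (\<Sum>x\<in>A \<rightarrow>\<^sub>E S. (\<Prod>a\<in>A. l (x a)) * f x ^ card B)"
    using weighted_power_mean[of "A \<rightarrow>\<^sub>E S" "\<lambda>x. \<Prod>a\<in>A. l (x a)" f "card B"] w0 f0 T0 A S
    by (simp add: Tpow finite_PiE)
  also have "\<dots> = (\<Sum>x\<in>A \<rightarrow>\<^sub>E S. \<Sum>y\<in>B \<rightarrow>\<^sub>E S. (\<Prod>a\<in>A. l (x a)) *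
                     (\<Prod>b\<in>B. l (y b) * (\<Prod>a\<in>A. of_bool (E (x a) (y b)))))"
  proof (intro sum.cong refl)
    fix x
    have "f x ^ card B = (\<Sum>y\<in>B \<rightarrow>\<^sub>E S. \<Prod>b\<in>B. l (y b) * (\<Prod>a\<in>A. of_bool (E (x a) (y b))))"
      using prod_sum_PiE[of B "\<lambda>_. S" "\<lambda>_ s. l s * (\<Prod>a\<in>A. of_bool (E (x a) s))"] B S by (simp add: f_def)
    then show "(\<Prod>a\<in>A. l (x a)) * f x ^ card B = (\<Sum>y\<in>B \<rightarrow>\<^sub>E S. (\<Prod>a\<in>A. l (x a)) *
                     (\<Prod>b\<in>B. l (y b) * (\<Prod>a\<in>A. of_bool (E (x a) (y b)))))"
      by (simp add: sum_distrib_left)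
  qed
  also have "\<dots> = (\<Sum>p\<in>(A \<rightarrow>\<^sub>E S) \<times> (B \<rightarrow>\<^sub>E S). (\<Prod>a\<in>A. l (fst p a)) *
                     (\<Prod>b\<in>B. l (snd p b) * (\<Prod>a\<in>A. of_bool (E (fst p a) (snd p b)))))"
    by (simp add: sum.cartesian_product case_prod_beta)
  also have "\<dots> = (\<Sum>h\<in>(A \<union> B) \<rightarrow>\<^sub>E S. (\<Prod>v\<in>A \<union> B. l (h v)) * (\<Prod>b\<in>B. \<Prod>a\<in>A. of_bool (E (h a) (h b))))"
  proof (rule sum.reindex_bij_witness[of _ "\<lambda>h. (restrict h A, restrict h B)"
        "\<lambda>p v. if v \<in> A then fst p v else snd p v"])
    fix p assume p: "p \<in> (A \<rightarrow>\<^sub>E S) \<times> (B \<rightarrow>\<^sub>E S)"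
    then obtain x y where xy: "p = (x, y)" "x \<in> A \<rightarrow>\<^sub>E S" "y \<in> B \<rightarrow>\<^sub>E S" by auto
    let ?h = "\<lambda>v. if v \<in> A then fst p v else snd p v"
    have hb: "?h b = y b" if "b \<in> B" for b using that AB xy by auto
    show "(restrict ?h A, restrict ?h B) = p"
      using xy hb by (auto simp: fun_eq_iff restrict_def PiE_def extensional_def)
    show "?h \<in> (A \<union> B) \<rightarrow>\<^sub>E S"
      using xy hb by (auto simp: PiE_def extensional_def)
    show "(\<Prod>v\<in>A \<union> B. l (?h v)) * (\<Prod>b\<in>B. \<Prod>a\<in>A. of_bool (E (?h a) (?h b)))
       = (\<Prod>a\<in>A. l (fst p a)) * (\<Prod>b\<in>B. l (snd p b) * (\<Prod>a\<in>A. of_bool (E (fst p a) (snd p b))))"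
      using hb xy by (simp add: prod.union_disjoint[OF A B AB] prod.distrib)
  next
    fix h assume h: "h \<in> (A \<union> B) \<rightarrow>\<^sub>E S"
    then show "(\<lambda>v. if v \<in> A then fst (restrict h A, restrict h B) v else snd (restrict h A, restrict h B) v) = h"
      by (auto simp: fun_eq_iff PiE_def extensional_def)
    show "(restrict h A, restrict h B) \<in> (A \<rightarrow>\<^sub>E S) \<times> (B \<rightarrow>\<^sub>E S)"
      using h by auto
  qed
  also have "\<dots> = (\<Sum>h\<in>bihoms E A B S. \<Prod>v\<in>A \<union> B. l (h v))"
    by (rule sum.mono_neutral_cong_right)
       (use A B S in \<open>auto simp: bihoms_def finite_PiE prod_zero_iff\<close>)
  finally show ?thesis by (simp add: T_def e_def)
qed

text \<open>Union bound over ordered pairs of distinct vertices with equal image: the second vertex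
  contributes a factor at most \<open>\<tau>\<close>, and the others sum to at most a power of the
  total weight.\<close>

lemma weight_noninjective_le:
  fixes l :: "'a \<Rightarrow> real" and V :: "'b set"
  assumes S: "finite S" and V: "finite V"
    and l: "\<And>u. u \<in> S \<Longrightarrow> 0 \<le> l u" "\<And>u. u \<in> S \<Longrightarrow> l u \<le> \<tau>" and \<tau>: "0 \<le> \<tau>"
  shows "(\<Sum>h | h \<in> V \<rightarrow>\<^sub>E S \<and> \<not> inj_on h V. \<Prod>v\<in>V. l (h v))
           \<le> real (card V) ^ 2 * (\<tau> * (\<Sum>u\<in>S. l u) ^ (card V - 1))"
proof -
  define P where "P = {p \<in> V \<times> V. fst p \<noteq> snd p}"
  have cP: "finite P" "card P \<le> card V ^ 2"
    using V card_mono[of "V \<times> V" P] by (auto simp: P_def card_cartesian_product power2_eq_square)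
  have wt: "0 \<le> (\<Prod>v\<in>V. l (h v))" if "h \<in> V \<rightarrow>\<^sub>E S" for h
    using that l by (auto intro!: prod_nonneg)
  have fin: "finite (V \<rightarrow>\<^sub>E S)" using S V by (intro finite_PiE) auto
  have one: "(\<Sum>h | h \<in> V \<rightarrow>\<^sub>E S \<and> h (fst p) = h (snd p). \<Prod>v\<in>V. l (h v)) \<le> \<tau> * (\<Sum>u\<in>S. l u) ^ (card V - 1)"
    if p: "p \<in> P" for p
  proof -
    obtain i j where ij: "p = (i, j)" "i \<in> V" "j \<in> V" "i \<noteq> j" using p by (auto simp: P_def)
    define Q where "Q = {h \<in> V \<rightarrow>\<^sub>E S. h i = h j}"
    \<comment> \<open>On \<open>Q\<close> the value at \<open>j\<close> repeats the value at
      \<open>i\<close>, so forgetting \<open>j\<close> loses nothing.\<close>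
    define R where "R h = restrict h (V - {j})" for h :: "'b \<Rightarrow> 'a"
    have inj: "inj_on R Q"
    proof (rule inj_onI)
      fix g h assume gh: "g \<in> Q" "h \<in> Q" "R g = R h"
      have "g v = h v" if "v \<in> V" "v \<noteq> j" for v
        using fun_cong[OF gh(3), of v] that by (simp add: R_def)
      with gh ij have "g v = h v" if "v \<in> V" for v
        using that by (cases "v = j") (auto simp: Q_def)
      then show "g = h" using gh by (auto simp: Q_def intro: PiE_ext)
    qed
    have "(\<Sum>h\<in>Q. \<Prod>v\<in>V. l (h v)) \<le> (\<Sum>h\<in>Q. \<tau> * (\<Prod>v\<in>V - {j}. l (R h v)))"
    proof (rule sum_mono)
      fix h assume h: "h \<in> Q"
      have "(\<Prod>v\<in>V. l (h v)) = l (h j) * (\<Prod>v\<in>V - {j}. l (h v))"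
        using V ij(3) by (rule prod.remove)
      also have "\<dots> \<le> \<tau> * (\<Prod>v\<in>V - {j}. l (h v))"
        using h l ij by (intro mult_right_mono prod_nonneg) (auto simp: Q_def)
      also have "(\<Prod>v\<in>V - {j}. l (h v)) = (\<Prod>v\<in>V - {j}. l (R h v))"
        by (intro prod.cong) (auto simp: R_def)
      finally show "(\<Prod>v\<in>V. l (h v)) \<le> \<tau> * (\<Prod>v\<in>V - {j}. l (R h v))" .
    qed
    also have "\<dots> = (\<Sum>g\<in>R ` Q. \<tau> * (\<Prod>v\<in>V - {j}. l (g v)))"
      by (simp add: sum.reindex[OF inj])
    also have "\<dots> \<le> (\<Sum>g\<in>(V - {j}) \<rightarrow>\<^sub>E S. \<tau> * (\<Prod>v\<in>V - {j}. l (g v)))"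
    proof (rule sum_mono2)
      fix g assume g: "g \<in> ((V - {j}) \<rightarrow>\<^sub>E S) - R ` Q"
      then show "0 \<le> \<tau> * (\<Prod>v\<in>V - {j}. l (g v))"
        by (intro mult_nonneg_nonneg prod_nonneg \<tau> ballI l) auto
    next
      show "R ` Q \<subseteq> (V - {j}) \<rightarrow>\<^sub>E S"
        by (auto simp: R_def Q_def dest: PiE_mem split: if_splits)
    qed (use S V in \<open>auto intro!: finite_PiE\<close>)
    also have "\<dots> = \<tau> * (\<Sum>u\<in>S. l u) ^ (card V - 1)"
      using prod_sum_PiE[of "V - {j}" "\<lambda>_. S" "\<lambda>_ y. l y"] V S ij
      by (simp add: sum_distrib_left[symmetric])
    finally show ?thesis by (simp add: Q_def ij)
  qed
  have "(\<Sum>h | h \<in> V \<rightarrow>\<^sub>E S \<and> \<not> inj_on h V. \<Prod>v\<in>V. l (h v))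
     \<le> (\<Sum>h\<in>V \<rightarrow>\<^sub>E S. \<Sum>p\<in>P. of_bool (h (fst p) = h (snd p)) * (\<Prod>v\<in>V. l (h v)))"
  proof (rule sum_le_included[where i = "\<lambda>h. h"])
    show "\<forall>h\<in>{h \<in> V \<rightarrow>\<^sub>E S. \<not> inj_on h V}. \<exists>g\<in>V \<rightarrow>\<^sub>E S. g = h \<and>
        (\<Prod>v\<in>V. l (h v)) \<le> (\<Sum>p\<in>P. of_bool (g (fst p) = g (snd p)) * (\<Prod>v\<in>V. l (g v)))"
    proof
      fix h assume h: "h \<in> {h \<in> V \<rightarrow>\<^sub>E S. \<not> inj_on h V}"
      then obtain i j where ij: "(i, j) \<in> P" "h i = h j" by (auto simp: inj_on_def P_def)
      have "of_bool (h (fst (i, j)) = h (snd (i, j))) * (\<Prod>v\<in>V. l (h v))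
          \<le> (\<Sum>p\<in>P. of_bool (h (fst p) = h (snd p)) * (\<Prod>v\<in>V. l (h v)))"
        by (rule member_le_sum) (use ij h wt[of h] cP in auto)
      with ij h show "\<exists>g\<in>V \<rightarrow>\<^sub>E S. g = h \<and>
        (\<Prod>v\<in>V. l (h v)) \<le> (\<Sum>p\<in>P. of_bool (g (fst p) = g (snd p)) * (\<Prod>v\<in>V. l (g v)))"
        by auto
    qed
  qed (use fin wt in \<open>auto intro!: sum_nonneg mult_nonneg_nonneg\<close>)
  also have "\<dots> = (\<Sum>p\<in>P. \<Sum>h\<in>V \<rightarrow>\<^sub>E S. of_bool (h (fst p) = h (snd p)) * (\<Prod>v\<in>V. l (h v)))"
    by (rule sum.swap)
  also have "\<dots> = (\<Sum>p\<in>P. \<Sum>h | h \<in> V \<rightarrow>\<^sub>E S \<and> h (fst p) = h (snd p). \<Prod>v\<in>V. l (h v))"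
    by (intro sum.cong sum.mono_neutral_cong_right) (use fin in auto)
  also have "\<dots> \<le> (\<Sum>p\<in>P. \<tau> * (\<Sum>u\<in>S. l u) ^ (card V - 1))"
    by (rule sum_mono[OF one])
  also have "\<dots> = real (card P) * (\<tau> * (\<Sum>u\<in>S. l u) ^ (card V - 1))" by simp
  also have "\<dots> \<le> real (card V) ^ 2 * (\<tau> * (\<Sum>u\<in>S. l u) ^ (card V - 1))"
    using cP(2) l \<tau>
    by (intro mult_right_mono mult_nonneg_nonneg zero_le_power sum_nonneg) (auto simp flip: of_nat_power)
  finally show ?thesis .
qed

section \<open>From injective homomorphisms to copies of F\<close>

lemma finite_copies:
  assumes "simple_graph G"
  shows "finite (copies F G)"
proof -
  have fin: "finite (verts G)" "finite (edges G)"
    using assms by (auto simp: simple_graph_def nsets_def intro: finite_subset[of _ "Pow (verts G)"])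
  have "copies F G \<subseteq> (\<lambda>(V, D). \<lparr>verts = V, edges = D\<rparr>) ` (Pow (verts G) \<times> Pow (edges G))"
  proof
    fix K assume "K \<in> copies F G"
    then have "K = (\<lambda>(V, D). \<lparr>verts = V, edges = D\<rparr>) (verts K, edges K)"
      "(verts K, edges K) \<in> Pow (verts G) \<times> Pow (edges G)"
      by (auto simp: copies_def subgraph_def)
    then show "K \<in> (\<lambda>(V, D). \<lparr>verts = V, edges = D\<rparr>) ` (Pow (verts G) \<times> Pow (edges G))"
      by (metis image_eqI)
  qed
  then show ?thesis
    using fin by (auto intro: finite_subset)
qed

text \<open>The copy takes only the images of edges of \<open>F\<close>, not all edges of
  \<open>G\<close> they span, so injectivity makes the map an isomorphism onto it.\<close>

lemma image_graph_copy:
  assumes F: "simple_graph F" and G: "simple_graph G"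
    and h: "inj_on h (verts F)" "h ` verts F \<subseteq> verts G"
    and e: "\<And>e. e \<in> edges F \<Longrightarrow> h ` e \<in> edges G"
  shows "\<lparr>verts = h ` verts F, edges = (`) h ` edges F\<rparr> \<in> copies F G"
proof -
  define K where "K = \<lparr>verts = h ` verts F, edges = (`) h ` edges F\<rparr>"
  have FE: "e \<subseteq> verts F" "card e = 2" if "e \<in> edges F" for e
    using that F by (auto simp: simple_graph_def nsets_def)
  have "simple_graph K"
    using F FE h by (auto simp: simple_graph_def K_def nsets_def card_image inj_on_subset finite_subset)
  then have sub: "subgraph K G"
    using h e by (auto simp: subgraph_def K_def)
  have edge_iff: "{h x, h y} \<in> (`) h ` edges F \<longleftrightarrow> {x, y} \<in> edges F"
    if xy: "x \<in> verts F" "y \<in> verts F" for x y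
  proof
    assume "{h x, h y} \<in> (`) h ` edges F"
    then obtain e where e: "e \<in> edges F" "h ` {x, y} = h ` e" by auto
    then have "{x, y} = e" using FE xy inj_on_image_eq_iff[OF h(1), of "{x, y}" e] by auto
    with e show "{x, y} \<in> edges F" by simp
  next
    assume "{x, y} \<in> edges F"
    then show "{h x, h y} \<in> (`) h ` edges F" by (rule rev_image_eqI) simp
  qed
  have "isomorphic K F"
    unfolding isomorphic_def
  proof (intro exI conjI ballI)
    show "bij_betw (inv_into (verts F) h) (verts K) (verts F)"
      using h(1) by (simp add: K_def bij_betw_inv_into inj_on_imp_bij_betw)
    show "({u, v} \<in> edges K) = ({inv_into (verts F) h u, inv_into (verts F) h v} \<in> edges F)"
      if uv: "u \<in> verts K" "v \<in> verts K" for u v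
    proof -
      obtain x y where xy: "u = h x" "v = h y" "x \<in> verts F" "y \<in> verts F"
        using uv by (auto simp: K_def)
      then show ?thesis
        using edge_iff[OF xy(3,4)] h(1) by (simp add: K_def)
    qed
  qed
  with sub show ?thesis by (simp add: copies_def K_def)
qed

text \<open>An injective homomorphism spans a copy of \<open>F\<close>, and a given copy contains
  the values of at most \<open>n ^ n\<close> maps of the \<open>n\<close> vertices. This crude
  factor covers the automorphisms.\<close>

lemma card_injective_bihoms_le:
  fixes F :: "'b graph" and G :: "'a graph"
  assumes F: "simple_graph F" and G: "simple_graph G"
    and AB: "A \<union> B = verts F" "\<forall>e\<in>edges F. \<exists>a\<in>A. \<exists>b\<in>B. e = {a, b}"
    and S: "S \<subseteq> verts G"
    and E: "\<And>u w. u \<in> S \<Longrightarrow> w \<in> S \<Longrightarrow> E u w \<Longrightarrow> {u, w} \<in> edges G"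
  shows "card {h \<in> bihoms E A B S. inj_on h (verts F)}
           \<le> card (verts F) ^ card (verts F) * card (copies F G)"
proof -
  define V where "V = verts F"
  define Q where "Q = {h \<in> bihoms E A B S. inj_on h V}"
  define K where "K h = \<lparr>verts = h ` V, edges = (`) h ` edges F\<rparr>" for h :: "'b \<Rightarrow> 'a"
  have finV: "finite V"
    using F by (simp add: V_def simple_graph_def)
  have Qmem: "h \<in> V \<rightarrow>\<^sub>E S" "inj_on h V" "\<And>a b. a \<in> A \<Longrightarrow> b \<in> B \<Longrightarrow> E (h a) (h b)" if "h \<in> Q" for h
    using that AB by (auto simp: Q_def bihoms_def V_def)
  have Kc: "K ` Q \<subseteq> copies F G"
  proof
    fix L assume "L \<in> K ` Q"
    then obtain h where h: "h \<in> Q" "L = K h" by auto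
    show "L \<in> copies F G"
      unfolding h K_def V_def
    proof (rule image_graph_copy[OF F G])
      show "inj_on h (verts F)" "h ` verts F \<subseteq> verts G"
        using Qmem[OF h(1)] S by (auto simp: V_def)
      fix e assume "e \<in> edges F"
      then obtain a b where ab: "a \<in> A" "b \<in> B" "e = {a, b}" using AB by blast
      then have "h a \<in> S" "h b \<in> S" using Qmem(1)[OF h(1)] AB by (auto simp: V_def)
      with ab Qmem(3)[OF h(1)] E show "h ` e \<in> edges G" by auto
    qed
  qed
  have fc: "finite (copies F G)" by (rule finite_copies[OF G])
  have fK: "finite (K ` Q)" by (rule finite_subset[OF Kc fc])
  have "Q \<subseteq> (\<Union>L\<in>K ` Q. V \<rightarrow>\<^sub>E verts L)"
    using Qmem by (fastforce simp: K_def)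
  moreover have fv: "finite (verts L)" "card (verts L) = card V" if "L \<in> K ` Q" for L
    using that Qmem finV by (auto simp: K_def card_image)
  ultimately have "card Q \<le> card (\<Union>L\<in>K ` Q. V \<rightarrow>\<^sub>E verts L)"
    using fK finV by (intro card_mono finite_UN_I finite_PiE) auto
  also have "\<dots> \<le> (\<Sum>L\<in>K ` Q. card (V \<rightarrow>\<^sub>E verts L))"
    by (rule card_UN_le[OF fK])
  also have "\<dots> = (\<Sum>L\<in>K ` Q. card V ^ card V)"
    by (intro sum.cong refl) (simp add: card_PiE finV fv)
  also have "\<dots> \<le> card V ^ card V * card (copies F G)"
    using card_mono[OF fc Kc] by simp
  finally show ?thesis by (simp add: Q_def V_def)
qed

text \<open>An edge weight above 1/2 would, by Sidorenko's inequality, give the maps in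
  \<open>bihoms\<close> at least the weight on the right of \<open>small\<close>. The injective ones
  weigh at most \<open>\<tau> ^ n\<close> each and are bounded in number through the copies; the
  others share a factor \<open>\<tau>\<close>. Together this is the left of
  \<open>small\<close>.\<close>

lemma edge_weight_le_half:
  fixes F :: "'b graph" and G :: "'a graph" and l :: "'a \<Rightarrow> real"
  defines "n \<equiv> card (verts F)"
  assumes F: "simple_graph F" and G: "simple_graph G"
    and AB: "A \<union> B = verts F" "A \<inter> B = {}" "\<forall>e\<in>edges F. \<exists>a\<in>A. \<exists>b\<in>B. e = {a, b}"
    and S: "S \<subseteq> verts G"
    and E: "\<And>u w. u \<in> S \<Longrightarrow> w \<in> S \<Longrightarrow> E u w \<Longrightarrow> {u, w} \<in> edges G"
    and l: "\<And>u. u \<in> S \<Longrightarrow> 0 \<le> l u" "\<And>u. u \<in> S \<Longrightarrow> l u \<le> \<tau>" and \<tau>: "0 \<le> \<tau>"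
    and T: "(\<Sum>u\<in>S. l u) \<le> Y" and Y: "1 \<le> Y"
    and small: "real n ^ n * real (card (copies F G)) * \<tau> ^ n + real n ^ 2 * \<tau> * Y ^ (n - 1)
                  < (1 / 2) ^ n * (1 / (2 * Y\<^sup>2)) ^ (n\<^sup>2)"
  shows "edge_weight E l S \<le> 1 / 2"
proof (rule ccontr)
  define T where "T = (\<Sum>u\<in>S. l u)"
  define e where "e = edge_weight E l S"
  define wt where "wt h = (\<Prod>v\<in>verts F. l (h v))" for h :: "'b \<Rightarrow> 'a"
  assume "\<not> edge_weight E l S \<le> 1 / 2"
  then have e: "1 / 2 < e" by (simp add: e_def)
  have finS: "finite S" using S G by (auto simp: simple_graph_def intro: finite_subset)
  have finV: "finite (verts F)" and finA: "finite A" and finB: "finite B"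
    using F finite_Un[of A B] unfolding AB by (simp_all add: simple_graph_def)
  have T0: "0 \<le> T" using l by (auto simp: T_def intro: sum_nonneg)
  have TY: "T \<le> Y" using T by (simp add: T_def)
  have "e \<le> (\<Sum>u\<in>S. \<Sum>w\<in>S. l u * l w)"
    unfolding e_def edge_weight_def using l by (intro sum_mono) (auto simp: mult_left_le)
  also have "\<dots> = T\<^sup>2" by (simp add: T_def power2_eq_square sum_product)
  finally have eT: "e \<le> T\<^sup>2" .
  \<comment> \<open>The factor \<open>T ^ n\<close> needs \<open>T\<close> bounded away from 0; this
    holds because the edge weight is at most \<open>T\<^sup>2\<close>.\<close>
  have T2: "1 / 2 < T"
  proof (rule ccontr)
    assume "\<not> 1 / 2 < T"
    then have "T\<^sup>2 \<le> (1 / 2)\<^sup>2" using T0 by (intro power_mono) auto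
    with e eT show False by (simp add: power2_eq_square)
  qed
  \<comment> \<open>Raising the exponent from \<open>card A * card B\<close> to
    \<open>n\<^sup>2\<close> is harmless since the base is at most 1.\<close>
  have "(1 / (2 * Y\<^sup>2)) ^ (n\<^sup>2) \<le> (1 / (2 * Y\<^sup>2)) ^ (card A * card B)"
  proof (rule power_decreasing)
    show "card A * card B \<le> n\<^sup>2"
      using AB finV unfolding n_def power2_eq_square by (intro mult_mono card_mono) auto
    show "1 / (2 * Y\<^sup>2) \<le> 1" using one_le_power[OF Y, of 2] by (simp add: divide_le_eq del: one_le_power)
  qed auto
  also have "\<dots> \<le> (e / T\<^sup>2) ^ (card A * card B)"
  proof (rule power_mono)
    have "1 / (2 * Y\<^sup>2) = (1 / 2) / Y\<^sup>2" by simp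
    also have "\<dots> \<le> e / T\<^sup>2" using e T2 TY by (intro frac_le power_mono) auto
    finally show "1 / (2 * Y\<^sup>2) \<le> e / T\<^sup>2" .
  qed auto
  finally have "(1 / 2) ^ n * (1 / (2 * Y\<^sup>2)) ^ (n\<^sup>2) \<le> T ^ n * (e / T\<^sup>2) ^ (card A * card B)"
    using T2 by (intro mult_mono power_mono) auto
  also have "\<dots> \<le> (\<Sum>h\<in>bihoms E A B S. wt h)"
    using bihoms_weight_ge[OF finS, of l A B E] l T2 finA finB AB
    by (simp add: n_def T_def e_def wt_def)
  also have "\<dots> \<le> (\<Sum>h\<in>{h \<in> bihoms E A B S. inj_on h (verts F)} \<union> {h \<in> verts F \<rightarrow>\<^sub>E S. \<not> inj_on h (verts F)}. wt h)"
  proof (rule sum_mono2)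
    show "finite ({h \<in> bihoms E A B S. inj_on h (verts F)} \<union> {h \<in> verts F \<rightarrow>\<^sub>E S. \<not> inj_on h (verts F)})"
      by (rule finite_subset[of _ "verts F \<rightarrow>\<^sub>E S"]) (use finV finS AB in \<open>auto simp: bihoms_def intro!: finite_PiE\<close>)
  qed (use AB l in \<open>auto simp: bihoms_def wt_def dest: PiE_mem intro!: prod_nonneg\<close>)
  also have "\<dots> = (\<Sum>h | h \<in> bihoms E A B S \<and> inj_on h (verts F). wt h)
                + (\<Sum>h | h \<in> verts F \<rightarrow>\<^sub>E S \<and> \<not> inj_on h (verts F). wt h)"
    by (rule sum.union_disjoint)
       (auto intro: finite_subset[of _ "verts F \<rightarrow>\<^sub>E S"] simp: bihoms_def AB finite_PiE finV finS)
  also have "\<dots> \<le> real n ^ n * real (card (copies F G)) * \<tau> ^ n + real n ^ 2 * (\<tau> * T ^ (n - 1))"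
  proof (rule add_mono)
    have "(\<Sum>h | h \<in> bihoms E A B S \<and> inj_on h (verts F). wt h)
       \<le> (\<Sum>h | h \<in> bihoms E A B S \<and> inj_on h (verts F). \<tau> ^ n)"
    proof (rule sum_mono)
      fix h assume "h \<in> {h \<in> bihoms E A B S. inj_on h (verts F)}"
      then have "wt h \<le> (\<Prod>v\<in>verts F. \<tau>)"
        unfolding wt_def using l AB by (intro prod_mono) (auto simp: bihoms_def dest: PiE_mem)
      then show "wt h \<le> \<tau> ^ n" by (simp add: n_def)
    qed
    also have "\<dots> = real (card {h \<in> bihoms E A B S. inj_on h (verts F)}) * \<tau> ^ n" by simp
    also have "\<dots> \<le> real (n ^ n * card (copies F G)) * \<tau> ^ n"
      unfolding n_def
      by (intro mult_right_mono of_nat_mono card_injective_bihoms_le[OF F G AB(1,3) S E] zero_le_power \<tau>)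
    finally show "(\<Sum>h | h \<in> bihoms E A B S \<and> inj_on h (verts F). wt h)
        \<le> real n ^ n * real (card (copies F G)) * \<tau> ^ n" by simp
    show "(\<Sum>h | h \<in> verts F \<rightarrow>\<^sub>E S \<and> \<not> inj_on h (verts F). wt h) \<le> real n ^ 2 * (\<tau> * T ^ (n - 1))"
      using weight_noninjective_le[OF finS finV l \<tau>] by (simp add: wt_def n_def T_def)
  qed
  also have "real n ^ 2 * (\<tau> * T ^ (n - 1)) \<le> real n ^ 2 * (\<tau> * Y ^ (n - 1))"
    using \<tau> T0 TY by (intro mult_left_mono power_mono) auto
  finally show False using small by simp
qed

subsection \<open>Counting colourings\<close>

definition colorings :: "('a \<Rightarrow> 'a \<Rightarrow> bool) \<Rightarrow> nat \<Rightarrow> 'a set \<Rightarrow> ('a \<Rightarrow> nat) set" where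
  "colorings E q W = {c \<in> W \<rightarrow>\<^sub>E {..<q}. \<forall>u\<in>W. \<forall>w\<in>W. E u w \<longrightarrow> c u \<noteq> c w}"

text \<open>For a proper \<open>c\<close> and an \<open>E\<close> without loops, the present colour
  of a vertex \<open>u\<close> of \<open>W\<close> is among its available ones; hence the shifts by
  1 when \<open>u\<close> is recoloured.\<close>

definition available :: "('a \<Rightarrow> 'a \<Rightarrow> bool) \<Rightarrow> nat \<Rightarrow> 'a set \<Rightarrow> ('a \<Rightarrow> nat) \<Rightarrow> 'a \<Rightarrow> nat set" where
  "available E q W c u = {..<q} - c ` {w \<in> W. E u w}"

lemma finite_colorings: "finite W \<Longrightarrow> finite (colorings E q W)"
  by (rule finite_subset[of _ "W \<rightarrow>\<^sub>E {..<q}"]) (auto simp: colorings_def intro!: finite_PiE)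

lemma finite_available: "finite (available E q W c u)"
  by (simp add: available_def)

lemma available_cong:
  "(\<And>w. w \<in> W \<Longrightarrow> E u w \<Longrightarrow> c w = c' w) \<Longrightarrow> available E q W c u = available E q W c' u"
  by (auto simp: available_def)

lemma bij_betw_colorings_insert:
  assumes v: "v \<notin> W" and E: "\<And>u w. E u w \<Longrightarrow> E w u" "\<And>u. \<not> E u u"
  shows "bij_betw (\<lambda>(c, \<gamma>). c(v := \<gamma>)) (SIGMA c:colorings E q W. available E q W c v)
           (colorings E q (insert v W))"
proof (rule bij_betw_byWitness[where f' = "\<lambda>c. (c(v := undefined), c v)"])
  \<comment> \<open>Extensionality forces the default \<open>undefined\<close> outside
    \<open>W\<close>, so resetting \<open>v\<close> to it undoes the insertion.\<close>
  have "c v = undefined" if "c \<in> colorings E q W" for c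
    using that v by (auto simp: colorings_def PiE_def extensional_def)
  then show "\<forall>p\<in>SIGMA c:colorings E q W. available E q W c v.
      ((case p of (c, \<gamma>) \<Rightarrow> c(v := \<gamma>))(v := undefined), (case p of (c, \<gamma>) \<Rightarrow> c(v := \<gamma>)) v) = p"
    by (force simp: fun_eq_iff)
  show "(\<lambda>(c, \<gamma>). c(v := \<gamma>)) ` (SIGMA c:colorings E q W. available E q W c v)
      \<subseteq> colorings E q (insert v W)"
    using v E by (fastforce simp: colorings_def available_def PiE_def extensional_def)
  show "(\<lambda>c. (c(v := undefined), c v)) ` colorings E q (insert v W)
      \<subseteq> (SIGMA c:colorings E q W. available E q W c v)"
    using v E by (fastforce simp: colorings_def available_def PiE_def extensional_def)
qed auto

lemma card_colorings_insert:
  assumes "finite W" "v \<notin> W" "\<And>u w. E u w \<Longrightarrow> E w u" "\<And>u. \<not> E u u"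
  shows "card (colorings E q (insert v W)) = (\<Sum>c\<in>colorings E q W. card (available E q W c v))"
  using bij_betw_same_card[OF bij_betw_colorings_insert[where E = E and q = q, OF assms(2-4)]] assms(1)
  by (simp add: finite_colorings finite_available)

text \<open>Reveal the colour of \<open>u\<close> last: the colours available at \<open>u\<close> do
  not depend on it, so a colouring of the rest with fewer than \<open>x\<close> of them extends in
  fewer than \<open>x\<close> ways. A lower bound on the growth of the number of colourings turns
  this into a small probability.\<close>

lemma card_few_available_le:
  fixes x :: real
  assumes W: "finite W" and u: "u \<in> W" and E: "\<And>u w. E u w \<Longrightarrow> E w u" "\<And>u. \<not> E u u" and x: "0 \<le> x"
  shows "real (card {c \<in> colorings E q W. real (card (available E q W c u)) < x})
           \<le> x * real (card (colorings E q (W - {u})))"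
proof -
  define W' where "W' = W - {u}"
  define Q where "Q = {c \<in> colorings E q W'. real (card (available E q W' c u)) < x}"
  have W': "finite W'" "u \<notin> W'" "W = insert u W'" using W u by (auto simp: W'_def)
  have bij: "bij_betw (\<lambda>(c, \<gamma>). c(u := \<gamma>)) (SIGMA c:colorings E q W'. available E q W' c u) (colorings E q W)"
    unfolding W'(3) by (rule bij_betw_colorings_insert[OF W'(2) E])
  have av: "available E q W (c(u := \<gamma>)) u = available E q W' c u" for c \<gamma>
    using W' E by (auto simp: available_def image_iff)
  have "{c \<in> colorings E q W. real (card (available E q W c u)) < x}
      \<subseteq> (\<lambda>(c, \<gamma>). c(u := \<gamma>)) ` (SIGMA c:Q. available E q W' c u)"
  proof
    fix c assume c: "c \<in> {c \<in> colorings E q W. real (card (available E q W c u)) < x}"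
    then have "c \<in> (\<lambda>(c, \<gamma>). c(u := \<gamma>)) ` (SIGMA c:colorings E q W'. available E q W' c u)"
      by (simp only: bij_betw_imp_surj_on[OF bij]) simp
    then obtain c' \<gamma> where c': "c' \<in> colorings E q W'" "\<gamma> \<in> available E q W' c' u" "c = c'(u := \<gamma>)"
      by auto
    with c have "(c', \<gamma>) \<in> (SIGMA c:Q. available E q W' c u)" by (auto simp: Q_def av)
    with c' show "c \<in> (\<lambda>(c, \<gamma>). c(u := \<gamma>)) ` (SIGMA c:Q. available E q W' c u)"
      by (intro image_eqI[of _ _ "(c', \<gamma>)"]) auto
  qed
  moreover have finQ: "finite Q" using W' by (simp add: Q_def finite_colorings)
  ultimately have "card {c \<in> colorings E q W. real (card (available E q W c u)) < x}
      \<le> card (SIGMA c:Q. available E q W' c u)"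
    by (meson card_image_le card_mono finite_SigmaI finite_available finite_imageI order.trans)
  also have "\<dots> = (\<Sum>c\<in>Q. card (available E q W' c u))"
    using finQ by (simp add: finite_available)
  finally have "real (card {c \<in> colorings E q W. real (card (available E q W c u)) < x})
      \<le> (\<Sum>c\<in>Q. real (card (available E q W' c u)))"
    by (simp flip: of_nat_sum)
  also have "\<dots> \<le> (\<Sum>c\<in>Q. x)" by (rule sum_mono) (auto simp: Q_def)
  also have "\<dots> = x * real (card Q)" by simp
  also have "\<dots> \<le> x * real (card (colorings E q W'))"
    using W' x by (intro mult_left_mono of_nat_mono card_mono) (auto simp: Q_def finite_colorings)
  finally show ?thesis by (simp add: W'_def)
qed

section \<open>Recolouring a colour class\<close>

text \<open>Recolouring the vertices of \<open>D\<close> of colour \<open>\<gamma>\<close> by uniformly random available colours turns a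
  uniformly random colouring into one that avoids \<open>\<gamma>\<close> on \<open>D\<close>. Given the result, the set of recoloured
  vertices is distributed as a hard-core model. No structure of \<open>E\<close> on \<open>D\<close> is needed because a
  colour class is independent.\<close>

lemma recoloring_identity:
  fixes g :: "'a set \<Rightarrow> real" and \<tau> :: real
  assumes W: "finite W" and D: "D \<subseteq> W" and \<tau>: "0 < \<tau>" and \<gamma>: "\<gamma> < q"
    and E: "\<And>u w. E u w \<Longrightarrow> E w u"
  shows "(\<Sum>c | c \<in> colorings E q W \<and> (\<forall>u\<in>D. c u = \<gamma> \<longrightarrow> \<tau> + 1 \<le> real (card (available E q W c u))).
             g {u \<in> D. c u = \<gamma>})
       = (\<Sum>c | c \<in> colorings E q W \<and> \<gamma> \<notin> c ` D.
            \<Sum>I\<in>indep_sets E {u \<in> D. \<gamma> \<in> available E q W c u \<and> \<tau> + 1 \<le> real (card (available E q W c u))}.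
              (\<Prod>u\<in>I. 1 / (real (card (available E q W c u)) - 1)) * g I)"
proof -
  define X where "X = colorings E q W"
  define av where "av = available E q W"
  define I where "I c = {u \<in> D. c u = \<gamma>}" for c
  define P where "P = {c \<in> X. \<forall>u\<in>D. c u = \<gamma> \<longrightarrow> \<tau> + 1 \<le> real (card (av c u))}"
  define Y where "Y = {c \<in> X. \<gamma> \<notin> c ` D}"
  define S where "S c = {u \<in> D. \<gamma> \<in> av c u \<and> \<tau> + 1 \<le> real (card (av c u))}" for c
  define R where "R c c' \<longleftrightarrow> (\<forall>x. x \<notin> I c \<longrightarrow> c' x = c x)" for c c' :: "'a \<Rightarrow> nat"
  define l where "l c u = 1 / (real (card (av c u)) - 1)" for c u
  have finX: "finite X" using W by (simp add: X_def finite_colorings)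
  have finI: "finite (I c)" for c using D W by (auto simp: I_def intro: finite_subset)
  have proper: "c u \<noteq> c w" if "c \<in> X" "u \<in> W" "w \<in> W" "E u w" for c u w
    using that by (auto simp: X_def colorings_def)
  have indep: "\<not> E u w" if "c \<in> X" "u \<in> I c" "w \<in> I c" for c u w
    using that proper[of c u w] D by (auto simp: I_def)
  \<comment> \<open>The class \<open>I c\<close> is independent, so the colours available on it are
    decided outside it and survive the recolouring.\<close>
  have avR: "av c' u = av c u" if "c \<in> X" "R c c'" "u \<in> I c" for c c' u
    unfolding av_def
  proof (rule available_cong)
    fix w assume "w \<in> W" "E u w"
    then have "w \<notin> I c" using indep that by blast
    with that show "c' w = c w" by (simp add: R_def)
  qed
  \<comment> \<open>The weights form a probability distribution on the recolourings of
    \<open>c\<close>: each vertex of the class independently takes an available colour other than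
    \<open>\<gamma>\<close>, and its fugacity is the reciprocal of the number of choices.\<close>
  have one: "(\<Sum>c' | c' \<in> Y \<and> R c c'. \<Prod>u\<in>I c. l c' u) = 1" if c: "c \<in> P" for c
  proof -
    have cX: "c \<in> X" and cI: "\<And>u. u \<in> I c \<Longrightarrow> \<tau> + 1 \<le> real (card (av c u))"
      using c by (auto simp: P_def I_def)
    have \<gamma>av: "\<gamma> \<in> av c u" if "u \<in> I c" for u
      using that cX \<gamma> D proper[of c u] by (auto simp: av_def available_def I_def)
    have "bij_betw (\<lambda>c'. restrict c' (I c)) {c' \<in> Y. R c c'} (PiE (I c) (\<lambda>u. av c u - {\<gamma>}))"
    proof (rule bij_betw_byWitness[where f' = "\<lambda>f x. if x \<in> I c then f x else c x"])
      show "\<forall>c'\<in>{c' \<in> Y. R c c'}. (\<lambda>x. if x \<in> I c then restrict c' (I c) x else c x) = c'"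
        by (auto simp: R_def fun_eq_iff)
      show "\<forall>f\<in>PiE (I c) (\<lambda>u. av c u - {\<gamma>}). restrict (\<lambda>x. if x \<in> I c then f x else c x) (I c) = f"
        by (auto simp: fun_eq_iff PiE_def extensional_def)
      show "(\<lambda>c'. restrict c' (I c)) ` {c' \<in> Y. R c c'} \<subseteq> PiE (I c) (\<lambda>u. av c u - {\<gamma>})"
      proof (clarsimp, intro conjI)
        fix c' u assume c': "c' \<in> Y" "R c c'" and u: "u \<in> I c"
        have "c' u \<in> av c' u"
          using c' u D proper[of c' u] by (auto simp: Y_def X_def I_def av_def available_def colorings_def)
        then show "c' u \<in> av c u" by (simp add: avR[OF cX c'(2) u])
        have "c' u \<in> c' ` D" using u by (simp add: I_def)
        then show "c' u \<noteq> \<gamma>" using c'(1) by (auto simp: Y_def)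
      qed
      show "(\<lambda>f x. if x \<in> I c then f x else c x) ` PiE (I c) (\<lambda>u. av c u - {\<gamma>}) \<subseteq> {c' \<in> Y. R c c'}"
      proof
        fix c' assume "c' \<in> (\<lambda>f x. if x \<in> I c then f x else c x) ` PiE (I c) (\<lambda>u. av c u - {\<gamma>})"
        then obtain f where f: "f \<in> PiE (I c) (\<lambda>u. av c u - {\<gamma>})"
          and c': "c' = (\<lambda>x. if x \<in> I c then f x else c x)" by auto
        have fu: "f u < q" "f u \<noteq> \<gamma>" "\<And>w. w \<in> W \<Longrightarrow> E u w \<Longrightarrow> f u \<noteq> c w" if "u \<in> I c" for u
          using f that by (force simp: av_def available_def dest: PiE_mem)+
        have "c' \<in> X"
          unfolding X_def colorings_def
        proof (intro CollectI conjI ballI impI)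
          show "c' \<in> W \<rightarrow>\<^sub>E {..<q}"
            using cX fu D by (auto simp: c' X_def colorings_def PiE_def extensional_def I_def)
          show "c' u \<noteq> c' w" if "u \<in> W" "w \<in> W" "E u w" for u w
            using that fu(3)[of u w] fu(3)[of w u] indep[OF cX, of u w] proper[OF cX, of u w] E[of u w]
            by (auto simp: c')
        qed
        moreover have "\<gamma> \<notin> c' ` D" using fu by (auto simp: c' I_def)
        ultimately show "c' \<in> {c' \<in> Y. R c c'}" by (auto simp: Y_def R_def c')
      qed
    qed
    then have card: "card {c' \<in> Y. R c c'} = (\<Prod>u\<in>I c. card (av c u - {\<gamma>}))"
      using card_PiE[OF finI[of c], where T = "\<lambda>u. av c u - {\<gamma>}"] by (simp add: bij_betw_same_card)
    have pos: "real (card (av c u - {\<gamma>})) = real (card (av c u)) - 1" "0 < real (card (av c u)) - 1"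
      if "u \<in> I c" for u
      using \<gamma>av[OF that] cI[OF that] \<tau> by (auto simp: card_Diff_singleton of_nat_diff)
    have "(\<Sum>c' | c' \<in> Y \<and> R c c'. \<Prod>u\<in>I c. l c' u) = (\<Sum>c' | c' \<in> Y \<and> R c c'. \<Prod>u\<in>I c. l c u)"
      by (intro sum.cong prod.cong refl) (use avR[OF cX] in \<open>auto simp: l_def\<close>)
    also have "\<dots> = (\<Prod>u\<in>I c. real (card (av c u)) - 1) * (\<Prod>u\<in>I c. l c u)"
      using pos by (simp add: card)
    also have "\<dots> = (\<Prod>u\<in>I c. (real (card (av c u)) - 1) * l c u)" by (simp add: prod.distrib)
    also have "\<dots> = 1" 
    proof (intro prod.neutral ballI)
      show "(real (card (av c u)) - 1) * l c u = 1" if "u \<in> I c" for u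
        using pos(2)[OF that] by (simp add: l_def)
    qed
    finally show ?thesis .
  qed
  have "(\<Sum>c\<in>P. g (I c)) = (\<Sum>c\<in>P. \<Sum>c' | c' \<in> Y \<and> R c c'. (\<Prod>u\<in>I c. l c' u) * g (I c))"
    using one by (simp flip: sum_distrib_right)
  also have "\<dots> = (\<Sum>c'\<in>Y. \<Sum>c | c \<in> P \<and> R c c'. (\<Prod>u\<in>I c. l c' u) * g (I c))"
    by (rule sum.swap_restrict) (use finX in \<open>auto simp: P_def Y_def\<close>)
  also have "\<dots> = (\<Sum>c'\<in>Y. \<Sum>J\<in>indep_sets E (S c'). (\<Prod>u\<in>J. l c' u) * g J)"
  proof (rule sum.cong[OF refl])
    fix c' assume c': "c' \<in> Y"
    show "(\<Sum>c | c \<in> P \<and> R c c'. (\<Prod>u\<in>I c. l c' u) * g (I c))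
        = (\<Sum>J\<in>indep_sets E (S c'). (\<Prod>u\<in>J. l c' u) * g J)"
    \<comment> \<open>Given the result \<open>c'\<close>, an origin is determined by its class:
      painting an independent set \<open>J\<close> of suitable vertices with \<open>\<gamma>\<close>
      recovers it.\<close>
    proof (rule sum.reindex_bij_witness[of _ "\<lambda>J x. if x \<in> J then \<gamma> else c' x" I])
      fix c assume "c \<in> {c. c \<in> P \<and> R c c'}"
      then have c: "c \<in> X" "R c c'" "\<And>u. u \<in> I c \<Longrightarrow> \<tau> + 1 \<le> real (card (av c u))"
        by (auto simp: P_def I_def)
      show "(\<lambda>x. if x \<in> I c then \<gamma> else c' x) = c"
        using c(2) by (auto simp: R_def fun_eq_iff I_def)
      have "\<gamma> \<in> av c u" if "u \<in> I c" for u
        using that c \<gamma> D proper[of c u] by (auto simp: av_def available_def I_def)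
      then show "I c \<in> indep_sets E (S c')"
        using c avR[OF c(1,2)] indep[OF c(1)] by (auto simp: indep_sets_def S_def) (auto simp: I_def)
    next
      fix J assume J: "J \<in> indep_sets E (S c')"
      define c where "c = (\<lambda>x. if x \<in> J then \<gamma> else c' x)"
      have JS: "J \<subseteq> S c'" "\<And>u w. u \<in> J \<Longrightarrow> w \<in> J \<Longrightarrow> \<not> E u w" using J by (auto simp: indep_sets_def)
      have Ic: "I c = J" using JS(1) c' by (auto simp: c_def I_def S_def Y_def)
      then show "I (\<lambda>x. if x \<in> J then \<gamma> else c' x) = J" by (simp add: c_def)
      have \<gamma>w: "c' w \<noteq> \<gamma>" if "u \<in> J" "w \<in> W" "E u w" for u w
        using that JS(1) by (auto simp: S_def av_def available_def)
      have cX: "c \<in> X"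
        unfolding X_def colorings_def
      proof (intro CollectI conjI ballI impI)
        show "c \<in> W \<rightarrow>\<^sub>E {..<q}"
          using c' JS(1) D \<gamma> by (auto simp: c_def Y_def X_def S_def colorings_def PiE_def extensional_def)
        show "c u \<noteq> c w" if "u \<in> W" "w \<in> W" "E u w" for u w
          using that \<gamma>w[of u w] \<gamma>w[of w u] JS(2)[of u w] proper[of c' u w] E[of u w] c'
          by (auto simp: c_def Y_def)
      qed
      have R: "R c c'" unfolding R_def Ic by (simp add: c_def)
      have "\<tau> + 1 \<le> real (card (av c u))" if "u \<in> J" for u
        using that JS(1) avR[OF cX R, of u] by (auto simp: Ic S_def)
      then show "(\<lambda>x. if x \<in> J then \<gamma> else c' x) \<in> {c. c \<in> P \<and> R c c'}"
        using cX R Ic unfolding c_def[symmetric] by (auto simp: P_def I_def)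
    qed auto
  qed
  finally show ?thesis
    by (simp add: P_def X_def I_def Y_def S_def l_def av_def)
qed

section \<open>Growth of the number of colourings\<close>

text \<open>The colours available at \<open>v\<close> are those missing on \<open>D\<close>. For
  each \<open>\<gamma>\<close>, recolouring and the tangent bound show that at least the sum of
  \<open>g\<close> over \<open>P \<gamma>\<close> colourings miss \<open>\<gamma>\<close>. As
  \<open>g\<close> is affine in the class size, it remains to bound the number of terms and the
  total class size over all colours.\<close>

lemma colorings_growth_step:
  fixes y \<tau> \<l> :: real and \<Delta> q :: nat
  assumes W: "finite W" and v: "v \<notin> W" and E: "\<And>u w. E u w \<Longrightarrow> E w u" "\<And>u. \<not> E u u"
    and deg: "card {w \<in> W. E v w} \<le> \<Delta>"
    and pos: "0 < \<l>" "0 < \<tau>" "0 \<le> y" and y\<tau>: "(y + 2) / \<tau> \<le> 1 / 2"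
    and IH: "\<And>u. u \<in> W \<Longrightarrow> \<l> * real (card (colorings E q (W - {u}))) \<le> real (card (colorings E q W))"
    and sparse: "\<And>S l'. S \<subseteq> {w \<in> W. E v w} \<Longrightarrow> (\<And>u. u \<in> S \<Longrightarrow> 0 \<le> l' u) \<Longrightarrow> (\<And>u. u \<in> S \<Longrightarrow> l' u \<le> 1 / \<tau>) \<Longrightarrow>
                   (\<Sum>u\<in>S. l' u) \<le> y + 2 \<Longrightarrow> edge_weight E l' S \<le> 1 / 2"
    and \<l>: "\<l> \<le> exp (- 1 - y) * ((1 + y) * (real q - real \<Delta> * (\<tau> + 1) / \<l>) - real \<Delta>)"
  shows "\<l> * real (card (colorings E q W)) \<le> real (card (colorings E q (insert v W)))"
proof -
  define X where "X = colorings E q W"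
  define av where "av = available E q W"
  define D where "D = {w \<in> W. E v w}"
  define few where "few c u \<longleftrightarrow> real (card (av c u)) < \<tau> + 1" for c u
  define P where "P \<gamma> = {c \<in> X. \<forall>u\<in>D. c u = \<gamma> \<longrightarrow> \<tau> + 1 \<le> real (card (av c u))}" for \<gamma>
  define g where "g I = exp (- 1 - y) * (1 + y - real (card I))" for I :: "'a set"
  have finX: "finite X" using W by (simp add: X_def finite_colorings)
  have finP: "finite (P \<gamma>)" for \<gamma> using finX by (simp add: P_def)
  have finD: "finite D" using W by (simp add: D_def)
  have DW: "D \<subseteq> W" by (auto simp: D_def)
  have cq: "c u < q" if "c \<in> X" "u \<in> D" for c u
    using that by (auto simp: X_def colorings_def D_def)
  have step: "(\<Sum>c\<in>P \<gamma>. g {u \<in> D. c u = \<gamma>}) \<le> real (card {c \<in> X. \<gamma> \<notin> c ` D})" if \<gamma>: "\<gamma> < q" for \<gamma>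
  proof -
    define S where "S c = {u \<in> D. \<gamma> \<in> av c u \<and> \<tau> + 1 \<le> real (card (av c u))}" for c
    have "(\<Sum>c\<in>P \<gamma>. g {u \<in> D. c u = \<gamma>})
        = (\<Sum>c | c \<in> X \<and> \<gamma> \<notin> c ` D. \<Sum>I\<in>indep_sets E (S c). (\<Prod>u\<in>I. 1 / (real (card (av c u)) - 1)) * g I)"
      using recoloring_identity[OF W DW pos(2) \<gamma> E(1), where g = g] by (simp add: P_def X_def av_def S_def)
    also have "\<dots> \<le> (\<Sum>c | c \<in> X \<and> \<gamma> \<notin> c ` D. 1)"
    proof (rule sum_mono)
      fix c
      have SD: "S c \<subseteq> D" by (auto simp: S_def)
      show "(\<Sum>I\<in>indep_sets E (S c). (\<Prod>u\<in>I. 1 / (real (card (av c u)) - 1)) * g I) \<le> 1"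
        unfolding g_def
      proof (rule hard_core_tangent[where \<tau> = "1 / \<tau>"])
        show "finite (S c)" using SD finD by (rule finite_subset)
        \<comment> \<open>Having \<open>\<tau> + 1\<close> available colours leaves at least
          \<open>\<tau>\<close> besides \<open>\<gamma>\<close>.\<close>
        show "1 / (real (card (av c u)) - 1) \<le> 1 / \<tau>" "0 \<le> 1 / (real (card (av c u)) - 1)" if "u \<in> S c" for u
          using that pos by (auto simp: S_def intro!: frac_le)
        show "1 / \<tau> * (y + 2) \<le> 1 / 2" using y\<tau> by simp
        show "edge_weight E l' (S c) \<le> 1 / 2"
          if "\<And>u. u \<in> S c \<Longrightarrow> 0 \<le> l' u" "\<And>u. u \<in> S c \<Longrightarrow> l' u \<le> 1 / \<tau>" "(\<Sum>u\<in>S c. l' u) \<le> y + 2" for l'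
          using sparse[of "S c" l'] SD that by (simp add: D_def)
      qed (use E pos in auto)
    qed
    finally show ?thesis by simp
  qed
  \<comment> \<open>A colouring outside \<open>P \<gamma>\<close> has a neighbour of
    \<open>v\<close> coloured \<open>\<gamma>\<close> with few available colours. Each neighbour has
    one colour and so is charged for a single \<open>\<gamma>\<close>, and \<open>IH\<close> bounds
    the colourings that are bad for it.\<close>
  have lower: "(real q - real \<Delta> * (\<tau> + 1) / \<l>) * real (card X) \<le> (\<Sum>\<gamma><q. real (card (P \<gamma>)))"
  proof -
    have "real q * real (card X) = (\<Sum>\<gamma><q. real (card X))" by simp
    also have "\<dots> \<le> (\<Sum>\<gamma><q. real (card (P \<gamma>)) + (\<Sum>u\<in>D. real (card {c \<in> X. few c u \<and> c u = \<gamma>})))"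
    proof (rule sum_mono)
      fix \<gamma>
      have "X \<subseteq> P \<gamma> \<union> (\<Union>u\<in>D. {c \<in> X. few c u \<and> c u = \<gamma>})"
        by (auto simp: P_def few_def)
      then have "card X \<le> card (P \<gamma> \<union> (\<Union>u\<in>D. {c \<in> X. few c u \<and> c u = \<gamma>}))"
        using finX finD by (intro card_mono) (auto simp: P_def)
      also have "\<dots> \<le> card (P \<gamma>) + (\<Sum>u\<in>D. card {c \<in> X. few c u \<and> c u = \<gamma>})"
        by (intro order.trans[OF card_Un_le] add_left_mono card_UN_le finD)
      finally show "real (card X) \<le> real (card (P \<gamma>)) + (\<Sum>u\<in>D. real (card {c \<in> X. few c u \<and> c u = \<gamma>}))"
        by (simp flip: of_nat_sum of_nat_add)
    qed
    also have "\<dots> = (\<Sum>\<gamma><q. real (card (P \<gamma>))) + (\<Sum>u\<in>D. \<Sum>\<gamma><q. real (card {c \<in> X. few c u \<and> c u = \<gamma>}))"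
      by (simp add: sum.distrib sum.swap[of _ D])
    also have "(\<Sum>u\<in>D. \<Sum>\<gamma><q. real (card {c \<in> X. few c u \<and> c u = \<gamma>})) = (\<Sum>u\<in>D. real (card {c \<in> X. few c u}))"
    proof (rule sum.cong[OF refl])
      fix u assume "u \<in> D"
      then show "(\<Sum>\<gamma><q. real (card {c \<in> X. few c u \<and> c u = \<gamma>})) = real (card {c \<in> X. few c u})"
        using sum.group[of "{c \<in> X. few c u}" "{..<q}" "\<lambda>c. c u" "\<lambda>_. 1::real"] finX cq
        by (auto simp: conj_assoc)
    qed
    also have "\<dots> \<le> (\<Sum>u\<in>D. (\<tau> + 1) / \<l> * real (card X))"
    proof (rule sum_mono)
      fix u assume u: "u \<in> D"
      then have uW: "u \<in> W" using DW by auto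
      have "real (card {c \<in> X. few c u}) \<le> (\<tau> + 1) * real (card (colorings E q (W - {u})))"
        using card_few_available_le[where E = E and x = "\<tau> + 1" and q = q, OF W uW E] pos by (simp add: X_def av_def few_def)
      also have "\<dots> \<le> (\<tau> + 1) * (real (card X) / \<l>)"
        using IH[OF uW] pos by (intro mult_left_mono) (auto simp: X_def field_simps)
      finally show "real (card {c \<in> X. few c u}) \<le> (\<tau> + 1) / \<l> * real (card X)" by simp
    qed
    also have "\<dots> = real (card D) * ((\<tau> + 1) / \<l> * real (card X))" by simp
    also have "\<dots> \<le> real \<Delta> * ((\<tau> + 1) / \<l> * real (card X))"
      using deg pos by (intro mult_right_mono) (auto simp: D_def)
    finally show ?thesis by (simp add: algebra_simps)
  qed
  \<comment> \<open>The colour classes partition \<open>D\<close>, so for each colouring their sizes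
    add up to at most \<open>\<Delta>\<close>.\<close>
  have upper: "(\<Sum>\<gamma><q. \<Sum>c\<in>P \<gamma>. real (card {u \<in> D. c u = \<gamma>})) \<le> real \<Delta> * real (card X)"
  proof -
    have "(\<Sum>\<gamma><q. \<Sum>c\<in>P \<gamma>. real (card {u \<in> D. c u = \<gamma>})) \<le> (\<Sum>\<gamma><q. \<Sum>c\<in>X. real (card {u \<in> D. c u = \<gamma>}))"
      by (intro sum_mono sum_mono2 finX) (auto simp: P_def)
    also have "\<dots> = (\<Sum>c\<in>X. \<Sum>\<gamma><q. real (card {u \<in> D. c u = \<gamma>}))" by (rule sum.swap)
    also have "\<dots> = (\<Sum>c\<in>X. real (card D))"
    proof (rule sum.cong[OF refl])
      fix c assume "c \<in> X"
      then show "(\<Sum>\<gamma><q. real (card {u \<in> D. c u = \<gamma>})) = real (card D)"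
        using sum.group[of D "{..<q}" c "\<lambda>_. 1::real"] finD cq by auto
    qed
    also have "\<dots> \<le> real \<Delta> * real (card X)"
      using deg by (simp add: D_def mult.commute[of "real \<Delta>"] mult_left_mono)
    finally show ?thesis .
  qed
  have "\<l> * real (card X)
      \<le> exp (- 1 - y) * ((1 + y) * (real q - real \<Delta> * (\<tau> + 1) / \<l>) - real \<Delta>) * real (card X)"
    by (intro mult_right_mono \<l>) auto
  also have "\<dots> = exp (- 1 - y) *
      ((1 + y) * ((real q - real \<Delta> * (\<tau> + 1) / \<l>) * real (card X)) - real \<Delta> * real (card X))"
    by (simp only: mult.assoc left_diff_distrib)
  also have "\<dots> \<le> exp (- 1 - y) * ((1 + y) * (\<Sum>\<gamma><q. real (card (P \<gamma>)))
      - (\<Sum>\<gamma><q. \<Sum>c\<in>P \<gamma>. real (card {u \<in> D. c u = \<gamma>})))"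
    using pos by (intro mult_left_mono diff_mono lower upper) auto
  also have "\<dots> = (\<Sum>\<gamma><q. \<Sum>c\<in>P \<gamma>. g {u \<in> D. c u = \<gamma>})"
    by (simp add: g_def sum_subtractf mult.commute flip: sum_distrib_left)
  also have "\<dots> \<le> (\<Sum>\<gamma><q. real (card {c \<in> X. \<gamma> \<notin> c ` D}))"
    by (rule sum_mono) (use step in auto)
  also have "\<dots> = (\<Sum>\<gamma><q. \<Sum>c | c \<in> X \<and> \<gamma> \<notin> c ` D. 1)" by simp
  also have "\<dots> = (\<Sum>c\<in>X. \<Sum>\<gamma> | \<gamma> \<in> {..<q} \<and> \<gamma> \<notin> c ` D. 1)"
    by (rule sum.swap_restrict) (use finX in auto)
  also have "\<dots> = (\<Sum>c\<in>X. real (card (av c v)))"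
    by (auto simp: av_def available_def D_def intro!: sum.cong arg_cong[where f = card])
  also have "\<dots> = real (card (colorings E q (insert v W)))"
    using card_colorings_insert[where E = E and q = q, OF W v E] by (simp add: X_def av_def)
  finally show ?thesis by (simp add: X_def)
qed

text \<open>Each inserted vertex multiplies the number of colourings by at least
  \<open>\<l>\<close>, so it stays positive from the one colouring of the empty set onwards.\<close>

lemma colorings_nonempty:
  fixes y \<tau> \<l> :: real and \<Delta> q :: nat
  assumes V: "finite V" and E: "\<And>u w. E u w \<Longrightarrow> E w u" "\<And>u. \<not> E u u"
    and deg: "\<And>v. v \<in> V \<Longrightarrow> card {w \<in> V. E v w} \<le> \<Delta>"
    and pos: "0 < \<l>" "0 < \<tau>" "0 \<le> y" and y\<tau>: "(y + 2) / \<tau> \<le> 1 / 2"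
    and sparse: "\<And>v S l'. v \<in> V \<Longrightarrow> S \<subseteq> {w \<in> V. E v w} \<Longrightarrow> (\<And>u. u \<in> S \<Longrightarrow> 0 \<le> l' u) \<Longrightarrow>
                   (\<And>u. u \<in> S \<Longrightarrow> l' u \<le> 1 / \<tau>) \<Longrightarrow> (\<Sum>u\<in>S. l' u) \<le> y + 2 \<Longrightarrow> edge_weight E l' S \<le> 1 / 2"
    and \<l>: "\<l> \<le> exp (- 1 - y) * ((1 + y) * (real q - real \<Delta> * (\<tau> + 1) / \<l>) - real \<Delta>)"
  shows "colorings E q V \<noteq> {}"
proof -
  \<comment> \<open>Claimed for all \<open>W\<close> and all \<open>v\<close> in \<open>W\<close> at
    once, because the step for \<open>v\<close> needs the ratio for removing any vertex from
    \<open>W - {v}\<close>.\<close>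
  have growth: "\<l> * real (card (colorings E q (W - {v}))) \<le> real (card (colorings E q W))"
    if "W \<subseteq> V" "v \<in> W" for W v
    using finite_subset[OF that(1) V] that
  proof (induction W arbitrary: v rule: finite_psubset_induct)
    case (psubset W)
    define W' where "W' = W - {v}"
    have W': "finite W'" "v \<notin> W'" "insert v W' = W" "W' \<subset> W" "W' \<subseteq> V" "v \<in> V"
      using psubset by (auto simp: W'_def)
    have sub: "{w \<in> W'. E v w} \<subseteq> {w \<in> V. E v w}" using W' by auto
    have "\<l> * real (card (colorings E q W')) \<le> real (card (colorings E q (insert v W')))"
    proof (rule colorings_growth_step[OF W'(1,2) E _ pos y\<tau> _ _ \<l>])
      show "card {w \<in> W'. E v w} \<le> \<Delta>"
        using card_mono[OF _ sub] deg[OF W'(6)] V by (simp add: order.trans)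
      show "\<l> * real (card (colorings E q (W' - {u}))) \<le> real (card (colorings E q W'))" if "u \<in> W'" for u
        using psubset.IH[OF W'(4,5) that] .
      show "edge_weight E l' S \<le> 1 / 2"
        if "S \<subseteq> {w \<in> W'. E v w}" "\<And>u. u \<in> S \<Longrightarrow> 0 \<le> l' u" "\<And>u. u \<in> S \<Longrightarrow> l' u \<le> 1 / \<tau>"
          "(\<Sum>u\<in>S. l' u) \<le> y + 2" for S l'
        using sparse[OF W'(6) subset_trans[OF that(1) sub] that(2-4)] .
    qed
    then show ?case unfolding W'(3) by (simp add: W'_def)
  qed
  have "0 < card (colorings E q W)" if "W \<subseteq> V" for W
    using finite_subset[OF that V] that
  proof (induction W rule: finite_induct)
    case empty
    then show ?case by (simp add: colorings_def)
  next
    case (insert v W)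
    then have "0 < \<l> * real (card (colorings E q W))" using pos by simp
    also have "\<dots> \<le> real (card (colorings E q (insert v W)))"
      using growth[OF insert.prems, of v] insert.hyps by simp
    finally show ?case by simp
  qed
  from this[of V] show ?thesis by auto
qed

text \<open>Each neighbourhood has at most \<open>k\<close> copies of \<open>F\<close>, so
  \<open>small\<close> bounds the edge weights of the hard-core models on it. What remains are
  inequalities between numbers.\<close>

lemma chromatic_number_le_of_locally_sparse:
  fixes F :: "'b graph" and G :: "'a graph" and y \<tau> \<l> k :: real and \<Delta> q :: nat
  defines "n \<equiv> card (verts F)"
  assumes F: "simple_graph F" "bipartite F" and G: "simple_graph G"
    and loc: "locally_sparse k F G" and deg: "max_degree G = \<Delta>"
    and pos: "0 < \<l>" "0 < \<tau>" "0 \<le> y" and y\<tau>: "(y + 2) / \<tau> \<le> 1 / 2"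
    and small: "real n ^ n * k * (1 / \<tau>) ^ n + real n ^ 2 * (1 / \<tau>) * (y + 2) ^ (n - 1)
                  < (1 / 2) ^ n * (1 / (2 * (y + 2)\<^sup>2)) ^ (n\<^sup>2)"
    and \<l>: "\<l> \<le> exp (- 1 - y) * ((1 + y) * (real q - real \<Delta> * (\<tau> + 1) / \<l>) - real \<Delta>)"
  shows "chromatic_number G \<le> q"
proof -
  define E where "E u w \<longleftrightarrow> {u, w} \<in> edges G" for u w
  have finV: "finite (verts G)" using G by (simp add: simple_graph_def)
  have EV: "u \<in> verts G" "w \<in> verts G" "u \<noteq> w" if "E u w" for u w
    using that G by (force simp: E_def simple_graph_def nsets_def)+
  obtain A B where AB: "A \<union> B = verts F" "A \<inter> B = {}" "\<forall>e\<in>edges F. \<exists>a\<in>A. \<exists>b\<in>B. e = {a, b}"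
    using F(2) unfolding bipartite_def by blast
  have "colorings E q (verts G) \<noteq> {}"
  proof (rule colorings_nonempty[OF finV _ _ _ pos y\<tau> _ \<l>])
    show "E w u" if "E u w" for u w using that by (simp add: E_def insert_commute)
    show "\<not> E u u" for u using EV by blast
    fix v assume v: "v \<in> verts G"
    have nb: "{w \<in> verts G. E v w} = neighborhood G v"
      using EV by (auto simp: neighborhood_def E_def insert_commute)
    have "degree G v \<le> max_degree G"
      unfolding max_degree_def using finV v by (intro Max_ge) auto
    then show "card {w \<in> verts G. E v w} \<le> \<Delta>" by (simp add: nb deg degree_def)
    define H where "H = induced_subgraph G (neighborhood G v)"
    have H: "simple_graph H"
      using G by (auto simp: H_def induced_subgraph_def simple_graph_def nsets_def)
    have "real_of_int (int (card (copies F H))) \<le> real_of_int \<lfloor>k\<rfloor>"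
      using loc v by (simp only: locally_sparse_def sparse_def H_def of_int_le_iff)
    then have cop: "real (card (copies F H)) \<le> k" by (simp add: order.trans[OF _ of_int_floor_le])
    fix S l'
    assume S: "S \<subseteq> {w \<in> verts G. E v w}"
      and l': "\<And>u. u \<in> S \<Longrightarrow> 0 \<le> l' u" "\<And>u. u \<in> S \<Longrightarrow> l' u \<le> 1 / \<tau>" "(\<Sum>u\<in>S. l' u) \<le> y + 2"
    show "edge_weight E l' S \<le> 1 / 2"
    proof (rule edge_weight_le_half[OF F(1) H AB _ _ l'(1,2) _ l'(3)])
      show "S \<subseteq> verts H" using S unfolding nb by (auto simp: H_def induced_subgraph_def nb[symmetric])
      show "{u, w} \<in> edges H" if "u \<in> S" "w \<in> S" "E u w" for u w
        using that S unfolding nb by (auto simp: H_def induced_subgraph_def E_def)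
      have "real n ^ n * real (card (copies F H)) * (1 / \<tau>) ^ n \<le> real n ^ n * k * (1 / \<tau>) ^ n"
        using cop pos by (intro mult_right_mono mult_left_mono) auto
      then show "real (card (verts F)) ^ card (verts F) * real (card (copies F H)) * (1 / \<tau>) ^ card (verts F)
          + (real (card (verts F)))\<^sup>2 * (1 / \<tau>) * (y + 2) ^ (card (verts F) - 1)
          < (1 / 2) ^ card (verts F) * (1 / (2 * (y + 2)\<^sup>2)) ^ (card (verts F))\<^sup>2"
        using small unfolding n_def by linarith
    qed (use pos in auto)
  qed
  then obtain c where c: "c \<in> colorings E q (verts G)" by blast
  have "proper_coloring G q c"
    unfolding proper_coloring_def
  proof (intro conjI allI impI)
    show "c ` verts G \<subseteq> {..<q}" using c by (auto simp: colorings_def)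
    show "c u \<noteq> c v" if "{u, v} \<in> edges G" for u v
      using c EV[of u v] that by (auto simp: colorings_def E_def)
  qed
  then show ?thesis
    unfolding chromatic_number_def by (intro Least_le) blast
qed

subsection \<open>Choice of the parameters\<close>

text \<open>A power of \<open>x\<close> beats a power of \<open>ln x\<close>: with
  \<open>p = x powr (1/10)\<close> the first summand is of order \<open>1 / p ^ n\<close> and the
  second carries \<open>1 / p ^ 2\<close>, while the right-hand side decays like a power of
  \<open>1 / ln x\<close>.\<close>

lemma eventually_few_copies_weight:
  fixes n :: nat
  assumes n: "0 < n"
  shows "eventually (\<lambda>x::real. real n ^ n * x powr (real n / 10) * (1 / x powr (1/5)) ^ n
      + real n ^ 2 * (1 / x powr (1/5)) * (2/3 * ln x + 2) ^ (n - 1)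
      < (1 / 2) ^ n * (1 / (2 * (2/3 * ln x + 2)\<^sup>2)) ^ (n\<^sup>2)) at_top"
proof -
  \<comment> \<open>Chosen so that the left-hand side is at most
    \<open>a * (Y ^ (n + 2 * n\<^sup>2) / p)\<close> times the right-hand side.\<close>
  define a where "a = (real n ^ n + real n ^ 2) * 2 ^ n * 2 ^ (n\<^sup>2)"
  have a: "0 < a" using n by (auto simp: a_def intro!: mult_pos_pos add_pos_pos)
  have "((\<lambda>x::real. (2/3 * ln x + 2) ^ (n + 2 * n\<^sup>2) / x powr (1/10)) \<longlongrightarrow> 0) at_top"
    by real_asymp
  then have "eventually (\<lambda>x::real. (2/3 * ln x + 2) ^ (n + 2 * n\<^sup>2) / x powr (1/10) < 1 / a) at_top"
    by (rule order_tendstoD) (use a in simp)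
  then show ?thesis
    using eventually_ge_at_top[of 1]
  proof eventually_elim
    case (elim x)
    define Y where "Y = 2/3 * ln x + 2"
    define p where "p = x powr (1/10)"
    have Y: "1 \<le> Y" using elim by (simp add: Y_def)
    have p: "1 \<le> p" using elim by (simp add: p_def ge_one_powr_ge_zero)
    have sq: "x powr (1/5) = p ^ 2"
      by (simp add: p_def power2_eq_square flip: powr_add)
    have pn: "x powr (real n / 10) = p ^ n"
      using elim p by (simp add: p_def powr_powr flip: powr_realpow)
    have "p ^ n * (1 / p ^ 2) ^ n = (1 / p) ^ n"
      using p by (simp add: power2_eq_square flip: power_mult_distrib)
    also have "\<dots> \<le> (1 / p) ^ 1" using n p by (intro power_decreasing) auto
    finally have p1: "p ^ n * (1 / p ^ 2) ^ n \<le> 1 / p" by simp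
    have p2: "1 / p ^ 2 \<le> 1 / p" using p by (simp add: power2_eq_square divide_le_eq)
    have t1: "real n ^ n * p ^ n * (1 / p ^ 2) ^ n \<le> real n ^ n * (1 / p) * Y ^ n"
    proof -
      have "real n ^ n * (p ^ n * (1 / p ^ 2) ^ n) \<le> real n ^ n * (1 / p)"
        by (intro mult_left_mono p1) auto
      also have "\<dots> \<le> real n ^ n * (1 / p) * Y ^ n"
        using mult_left_mono[OF one_le_power[OF Y, of n], of "real n ^ n * (1 / p)"] p by simp
      finally show ?thesis by (simp only: mult.assoc)
    qed
    have t2: "real n ^ 2 * (1 / p ^ 2) * Y ^ (n - 1) \<le> real n ^ 2 * (1 / p) * Y ^ n"
      using p Y by (intro mult_mono mult_left_mono p2 power_increasing) auto
    have "real n ^ n * p ^ n * (1 / p ^ 2) ^ n + real n ^ 2 * (1 / p ^ 2) * Y ^ (n - 1)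
        \<le> (real n ^ n + real n ^ 2) * (Y ^ n / p)"
      using add_mono[OF t1 t2] by (simp add: algebra_simps)
    also have "\<dots> = a * (Y ^ (n + 2 * n\<^sup>2) / p) * ((1 / 2) ^ n * (1 / (2 * Y\<^sup>2)) ^ (n\<^sup>2))"
      using Y p by (simp add: a_def power_add power_mult power_mult_distrib power_divide)
    also have "\<dots> < 1 * ((1 / 2) ^ n * (1 / (2 * Y\<^sup>2)) ^ (n\<^sup>2))"
      using elim(1) a Y unfolding Y_def[symmetric] p_def[symmetric]
      by (intro mult_strict_right_mono mult_pos_pos zero_less_power) (auto simp: field_simps)
    finally show ?case by (simp add: Y_def sq pn)
  qed
qed

theorem theorem1p8:
  fixes \<epsilon> :: real and F :: "'b graph"
  assumes "\<epsilon> > 0"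
    and "simple_graph F" and "verts F \<noteq> {}" and "bipartite F"
  shows "\<exists>\<Delta>\<^sub>0::nat. \<forall>\<Delta>\<ge>\<Delta>\<^sub>0. \<forall>(k::real) (C::real) (G::'a graph).
      1 / 2 \<le> k \<longrightarrow> k \<le> real \<Delta> powr (real (card (verts F)) / 10) \<longrightarrow>
      C = (if k \<le> real \<Delta> powr (\<epsilon> * real (card (verts F)) / 200) then 4 + \<epsilon> else 8) \<longrightarrow>
      simple_graph G \<longrightarrow> locally_sparse k F G \<longrightarrow> max_degree G = \<Delta> \<longrightarrow>
      real (chromatic_number G)
        \<le> C * real \<Delta> / ln (real \<Delta> * k powr (- 1 / real (card (verts F))))"
proof -
  define n where "n = card (verts F)"
  have n: "0 < n" using assms by (simp add: n_def simple_graph_def card_gt_0_iff)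
  \<comment> \<open>The slack between 4 and 3 absorbs \<open>ln 2\<close> and, through the
    \<open>- 1\<close>, the rounding of \<open>q\<close>.\<close>
  have "eventually (\<lambda>x::real. 3 * x / ln x \<le> 4 * x / (ln x + ln 2) - 1) at_top"
    by real_asymp
  moreover have "eventually (\<lambda>x::real. x * (x powr (1/5) + 1) / x powr (1/4) \<le> 3 * x / ln x / 2) at_top"
    by real_asymp
  moreover have "eventually (\<lambda>x::real. x powr (1/4) \<le> exp (- 1 - 2/3 * ln x) * (3 * x / ln x / 2)) at_top"
    by real_asymp
  moreover have "eventually (\<lambda>x::real. (2/3 * ln x + 2) / x powr (1/5) \<le> 1 / 2) at_top"
    by real_asymp
  ultimately have "eventually (\<lambda>x::real. 2 \<le> x \<and>
      3 * x / ln x \<le> 4 * x / (ln x + ln 2) - 1 \<and>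
      x * (x powr (1/5) + 1) / x powr (1/4) \<le> 3 * x / ln x / 2 \<and>
      x powr (1/4) \<le> exp (- 1 - 2/3 * ln x) * (3 * x / ln x / 2) \<and>
      (2/3 * ln x + 2) / x powr (1/5) \<le> 1 / 2 \<and>
      real n ^ n * x powr (real n / 10) * (1 / x powr (1/5)) ^ n
      + real n ^ 2 * (1 / x powr (1/5)) * (2/3 * ln x + 2) ^ (n - 1)
      < (1 / 2) ^ n * (1 / (2 * (2/3 * ln x + 2)\<^sup>2)) ^ (n\<^sup>2)) at_top"
    using eventually_few_copies_weight[OF n] eventually_ge_at_top[of 2]
    by (intro eventually_conj)
  then obtain x0 :: real where x0: "\<And>x. x0 \<le> x \<Longrightarrow> 2 \<le> x"
      "\<And>x. x0 \<le> x \<Longrightarrow> 3 * x / ln x \<le> 4 * x / (ln x + ln 2) - 1"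
      "\<And>x. x0 \<le> x \<Longrightarrow> x * (x powr (1/5) + 1) / x powr (1/4) \<le> 3 * x / ln x / 2"
      "\<And>x. x0 \<le> x \<Longrightarrow> x powr (1/4) \<le> exp (- 1 - 2/3 * ln x) * (3 * x / ln x / 2)"
      "\<And>x. x0 \<le> x \<Longrightarrow> (2/3 * ln x + 2) / x powr (1/5) \<le> 1 / 2"
      "\<And>x. x0 \<le> x \<Longrightarrow> real n ^ n * x powr (real n / 10) * (1 / x powr (1/5)) ^ n
      + real n ^ 2 * (1 / x powr (1/5)) * (2/3 * ln x + 2) ^ (n - 1)
      < (1 / 2) ^ n * (1 / (2 * (2/3 * ln x + 2)\<^sup>2)) ^ (n\<^sup>2)"
    unfolding eventually_at_top_linorder by blast
  show ?thesis
  proof (intro exI allI impI)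
    fix \<Delta> :: nat and k C :: real and G :: "'a graph"
    assume \<Delta>: "nat \<lceil>x0\<rceil> \<le> \<Delta>" and k: "1 / 2 \<le> k" "k \<le> real \<Delta> powr (real (card (verts F)) / 10)"
      and C: "C = (if k \<le> real \<Delta> powr (\<epsilon> * real (card (verts F)) / 200) then 4 + \<epsilon> else 8)"
      and G: "simple_graph G" "locally_sparse k F G" "max_degree G = \<Delta>"
    define x where "x = real \<Delta>"
    have "x0 \<le> x" using \<Delta> by (simp add: x_def nat_le_iff ceiling_le_iff)
    note x = x0[OF this]
    \<comment> \<open>The summand \<open>ln 2\<close> anticipates that
      \<open>k powr (- 1 / real n)\<close> is at most 2 for \<open>k\<close> at least 1/2.\<close>
    define q where "q = nat \<lfloor>4 * x / (ln x + ln 2)\<rfloor>"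
    \<comment> \<open>This is \<open>2 * x / q\<close> with \<open>q\<close> replaced by its lower
      bound \<open>3 * x / ln x\<close>; thus \<open>exp (- y)\<close> is
      \<open>x powr (- 2/3)\<close>.\<close>
    define y where "y = 2/3 * ln x"
    have lnx: "0 < ln x" using x(1) by simp
    have q_le: "real q \<le> 4 * x / (ln x + ln 2)"
      using x(1) lnx by (simp add: q_def)
    have q_ge: "3 * x / ln x \<le> real q"
      using x(2) unfolding q_def by linarith
    have "chromatic_number G \<le> q"
    \<comment> \<open>The exponents satisfy 1/10 < 1/5 < 1/4 < 1/3: \<open>\<tau>\<close> outweighs
      the copies, vertices with few colours are rare because \<open>\<tau>\<close> is well below
      \<open>\<l>\<close>, and \<open>\<l>\<close> stays below \<open>exp (- 1 - y) * q\<close>,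
      which is of order \<open>x powr (1/3) / ln x\<close>.\<close>
    proof (rule chromatic_number_le_of_locally_sparse[OF assms(2,4) G, where \<tau> = "x powr (1/5)" and y = y and \<l> = "x powr (1/4)"])
      show "(y + 2) / x powr (1/5) \<le> 1 / 2" using x(5) by (simp add: y_def)
      have "real n ^ n * k * (1 / x powr (1/5)) ^ n \<le> real n ^ n * x powr (real n / 10) * (1 / x powr (1/5)) ^ n"
        using k(2) by (intro mult_right_mono mult_left_mono) (auto simp: n_def x_def)
      then show "real (card (verts F)) ^ card (verts F) * k * (1 / x powr (1/5)) ^ card (verts F)
          + (real (card (verts F)))\<^sup>2 * (1 / x powr (1/5)) * (y + 2) ^ (card (verts F) - 1)
          < (1 / 2) ^ card (verts F) * (1 / (2 * (y + 2)\<^sup>2)) ^ (card (verts F))\<^sup>2"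
        using x(6) unfolding n_def y_def by linarith
      have half: "3 * x / ln x / 2 \<le> real q / 2"
        using q_ge by (rule divide_right_mono) simp
      then have "real q / 2 \<le> real q - x * (x powr (1/5) + 1) / x powr (1/4)"
        using x(3) by argo
      then have "(1 + y) * (real q / 2) \<le> (1 + y) * (real q - x * (x powr (1/5) + 1) / x powr (1/4))"
        using lnx by (intro mult_left_mono) (auto simp: y_def)
      \<comment> \<open>This pays for the subtracted degree; of
        \<open>(1 + y) * (real q / 2)\<close> a whole \<open>real q / 2\<close> is left
        over.\<close>
      moreover have "x \<le> y * (real q / 2)"
      proof -
        have "x = y * ((3 * x / ln x) / 2)" using lnx by (simp add: y_def)
        also have "\<dots> \<le> y * (real q / 2)" using q_ge lnx by (intro mult_left_mono) (auto simp: y_def)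
        finally show ?thesis .
      qed
      moreover have "(1 + y) * (real q / 2) = real q / 2 + y * (real q / 2)" by (simp add: algebra_simps)
      ultimately have "3 * x / ln x / 2 \<le> (1 + y) * (real q - x * (x powr (1/5) + 1) / x powr (1/4)) - x"
        using half by argo
      then have "exp (- 1 - y) * (3 * x / ln x / 2)
          \<le> exp (- 1 - y) * ((1 + y) * (real q - x * (x powr (1/5) + 1) / x powr (1/4)) - x)"
        by (intro mult_left_mono) auto
      with x(4) show "x powr (1/4) \<le> exp (- 1 - y) * ((1 + y) *
          (real q - real \<Delta> * (x powr (1/5) + 1) / x powr (1/4)) - real \<Delta>)"
        by (simp add: y_def x_def)
    qed (use x(1) lnx in \<open>auto simp: y_def\<close>)
    then have "real (chromatic_number G) \<le> 4 * x / (ln x + ln 2)"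
      using q_le by linarith
    \<comment> \<open>Both values of \<open>C\<close> are at least 4, so it remains to compare the
      denominators.\<close>
    also have "\<dots> \<le> C * x / ln (x * k powr (- 1 / real n))"
    proof (rule frac_le)
      show "4 * x \<le> C * x" "0 \<le> C * x" using C assms(1) x(1) by (auto intro!: mult_right_mono)
      have kpos: "0 < k" using k(1) by linarith
      have "ln (x * k powr (- 1 / real n)) = ln x - ln k / real n"
        using x(1) kpos by (simp add: ln_mult ln_powr)
      moreover have "- ln k / real n \<le> ln 2"
      proof -
        have "- ln 2 \<le> ln k" using k(1) kpos ln_le_cancel_iff[of "1/2" k] by (simp add: ln_div)
        then have "- ln k \<le> ln 2 * 1" by simp
        also have "\<dots> \<le> ln 2 * real n" using n by (intro mult_left_mono) auto
        finally show ?thesis using n by (intro iffD2[OF pos_divide_le_eq]) auto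
      qed
      \<comment> \<open>The upper bound on \<open>k\<close> keeps the final logarithm positive, as
        comparing the fractions requires.\<close>
      moreover have "ln k / real n < ln x"
      proof -
        have "ln k \<le> ln (x powr (real n / 10))"
          using k(2) kpos by (intro ln_mono) (simp_all add: n_def x_def)
        also have "\<dots> = real n / 10 * ln x" using x(1) by (simp add: ln_powr)
        also have "\<dots> < real n * ln x" using n lnx by simp
        finally show ?thesis using n by (simp add: divide_less_eq mult.commute)
      qed
      ultimately show "ln (x * k powr (- 1 / real n)) \<le> ln x + ln 2"
        "0 < ln (x * k powr (- 1 / real n))" by auto
    qed
    finally show "real (chromatic_number G)
        \<le> C * real \<Delta> / ln (real \<Delta> * k powr (- 1 / real (card (verts F))))"
      by (simp add: x_def n_def)
  qed
qed

end
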